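(* Let $\mathcal{C}$ be either the category of affine schemes or the category of Noetherian affine schemes, made into a site by some pretopology. For $\operatorname{Spec}A$ in $\mathcal{C}$ assume that every covering $\{\operatorname{Spec}A_i\to\operatorname{Spec}A\}_{i\in I}$ has a refinement to a covering $\{\operatorname{Spec}B_j\to\operatorname{Spec}A\}_{j\in J}$ where the $B_j$ are integral domains. Then the map $\underline{\mathbb{Z}}(A)^{\sharp}\to W_{\mathrm{rat}}(A)^{\sharp}$ induced by $\omega$ is injective.
   Context: All rings are commutative and unital; the category $\mathcal{C}$ is taken in a suitable small version. For a ring $A$ let $\mathbb{Z}A$ be the monoid ring of the multiplicative monoid $(A,\cdot)$, with basis elements written $(a)$, and let $\underline{\mathbb{Z}}A=\mathbb{Z}A/\mathbb{Z}(0)$ be the reduced monoid ring, the quotient by the ideal $\mathbb{Z}(0)$. $W(A)=1+TA[[T]]$ is the big Witt ring: addition is multiplication of power series (zero element $1$), multiplication is the unique functorial, $T$-adically continuous one with $(1-aT)\cdot(1-bT)=1-abT$, unit $1-T$. $W_{\mathrm{rat}}(A)\subset W(A)$ is the subring of elements $P/Q$ with $P,Q\in A[T]$, $P(0)=1=Q(0)$. The functorial ring homomorphism $\omega:\underline{\mathbb{Z}}A\to W_{\mathrm{rat}}(A)$ is induced by the multiplicative map $a\mapsto[a]=1-aT$. $\underline{\mathbb{Z}}(\mathcal{O})$ and $W_{\mathrm{rat}}(\mathcal{O})$ are the presheaves $Y\mapsto\underline{\mathbb{Z}}\,\mathcal{O}(Y)$ and $Y\mapsto W_{\mathrm{rat}}(\mathcal{O}(Y))$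 on $\mathcal{C}$, ${}^{\sharp}$ denotes sheafification with respect to the given (not necessarily subcanonical) pretopology, and $\underline{\mathbb{Z}}(A)^{\sharp}:=\underline{\mathbb{Z}}(\mathcal{O})^{\sharp}(\operatorname{Spec}A)$, $W_{\mathrm{rat}}(A)^{\sharp}:=W_{\mathrm{rat}}(\mathcal{O})^{\sharp}(\operatorname{Spec}A)$. A covering $\{\operatorname{Spec}B_j\to\operatorname{Spec}A\}_{j\in J}$ refines $\{\operatorname{Spec}A_i\to\operatorname{Spec}A\}_{i\in I}$ if there are a map $J\to I$, $j\mapsto i(j)$, and $A$-algebra homomorphisms $A_{i(j)}\to B_j$ for all $j\in J$. *)

theory Defs
  imports
    "HOL-Algebra.Ring_Divisibility"
    "HOL-Algebra.UnivPoly"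
    "HOL-Algebra.QuotRing"
    "HOL-Algebra.Free_Abelian_Groups"
begin

section \<open>Affine schemes\<close>

text \<open>
  The category of affine schemes is the opposite of the category of commutative rings, so we
  speak of rings throughout; a morphism Spec B -> Spec A is a ring homomorphism A -> B.
  The small version of the category consists of the rings whose elements are taken from a fixed
  but arbitrary type \<open>'u\<close>; if that type is infinite these are, up to isomorphism, the
  rings of cardinality at most that of \<open>'u\<close>.
\<close>

definition affine_schemes :: "'u ring set"
  where "affine_schemes = {A. cring A}"

definition noetherian_affine_schemes :: "'u ring set"
  where "noetherian_affine_schemes = {A. cring A \<and> noetherian_ring A}"

text \<open>
  HOL functions are total. Homomorphisms are required to be extensional so that equality of
  homomorphisms is equality on the carrier; they are composed with \<^const>\<open>compose\<close>.
\<close>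

definition rhom :: "'u ring \<Rightarrow> 'u ring \<Rightarrow> ('u \<Rightarrow> 'u) set"
  where "rhom A B = ring_hom A B \<inter> extensional (carrier A)"

definition rid :: "'u ring \<Rightarrow> 'u \<Rightarrow> 'u"
  where "rid A = restrict id (carrier A)"

text \<open>
  \<open>(P, p, q)\<close> is a pushout in \<open>C\<close> of \<open>B <- A -> B'\<close>, that is, Spec P with these two
  projections is the fibre product of Spec B and Spec B' over Spec A.
\<close>

definition is_pushout ::
  "'u ring set \<Rightarrow> 'u ring \<Rightarrow> 'u ring \<Rightarrow> ('u \<Rightarrow> 'u) \<Rightarrow> 'u ring \<Rightarrow> ('u \<Rightarrow> 'u)
    \<Rightarrow> 'u ring \<Rightarrow> ('u \<Rightarrow> 'u) \<Rightarrow> ('u \<Rightarrow> 'u) \<Rightarrow> bool"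
  where "is_pushout C A B f B' f' P p q \<longleftrightarrow>
    P \<in> C \<and> p \<in> rhom B P \<and> q \<in> rhom B' P \<and>
    compose (carrier A) p f = compose (carrier A) q f' \<and>
    (\<forall>Q\<in>C. \<forall>u\<in>rhom B Q. \<forall>v\<in>rhom B' Q.
      compose (carrier A) u f = compose (carrier A) v f' \<longrightarrow>
      (\<exists>!w. w \<in> rhom P Q \<and> compose (carrier B) w p = u \<and> compose (carrier B') w q = v))"


section \<open>Pretopologies\<close>

text \<open>
  A family of morphisms with target Spec A is given as a set of pairs \<open>(B, f)\<close> with
  \<open>f : A -> B\<close>. For the base change of such a family along \<open>g : A -> A'\<close> one may choose any
  fibre product for each member.
\<close>

type_synonym 'u arrow = "'u ring \<times> ('u \<Rightarrow> 'u)"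

type_synonym 'u coverings = "'u ring \<Rightarrow> 'u arrow set set"

locale pretopology =
  fixes C :: "'u ring set" and Cov :: "'u coverings"
  assumes family:
      "A \<in> C \<Longrightarrow> R \<in> Cov A \<Longrightarrow> (B, f) \<in> R \<Longrightarrow> B \<in> C \<and> f \<in> rhom A B"
    and iso:
      "A \<in> C \<Longrightarrow> B \<in> C \<Longrightarrow> f \<in> rhom A B \<Longrightarrow> f \<in> ring_iso A B \<Longrightarrow> {(B, f)} \<in> Cov A"
    and base_change_exists:
      "A \<in> C \<Longrightarrow> R \<in> Cov A \<Longrightarrow> (B, f) \<in> R \<Longrightarrow> A' \<in> C \<Longrightarrow> g \<in> rhom A A' \<Longrightarrow>
        \<exists>P p q. is_pushout C A A' g B f P p q"
    and base_change:
      "A \<in> C \<Longrightarrow> R \<in> Cov A \<Longrightarrow> A' \<in> C \<Longrightarrow> g \<in> rhom A A' \<Longrightarrow>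
        (\<And>B f. (B, f) \<in> R \<Longrightarrow> \<exists>q. is_pushout C A A' g B f (P (B, f)) (p (B, f)) q) \<Longrightarrow>
        (\<lambda>m. (P m, p m)) ` R \<in> Cov A'"
    and composition:
      "A \<in> C \<Longrightarrow> R \<in> Cov A \<Longrightarrow> (\<And>B f. (B, f) \<in> R \<Longrightarrow> S (B, f) \<in> Cov B) \<Longrightarrow>
        {(D, compose (carrier A) g f) | B f D g. (B, f) \<in> R \<and> (D, g) \<in> S (B, f)} \<in> Cov A"

definition refines_covering :: "'u ring \<Rightarrow> 'u arrow set \<Rightarrow> 'u arrow set \<Rightarrow> bool"
  where "refines_covering A S R \<longleftrightarrow>
    (\<forall>(B, g)\<in>S. \<exists>(A', f)\<in>R. \<exists>h\<in>rhom A' B. compose (carrier A) h f = g)"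


section \<open>Presheaves and sheafification\<close>

text \<open>
  \<open>sect F A\<close> is the set F(Spec A), and \<open>res F A B f\<close> is the map F(Spec A) -> F(Spec B)
  attached to \<open>f : A -> B\<close>.
  Sheafification of presheaves of rings or of abelian groups is carried out on the underlying
  presheaves of sets.
\<close>

record ('u, 'x) presheaf =
  sect :: "'u ring \<Rightarrow> 'x set"
  res :: "'u ring \<Rightarrow> 'u ring \<Rightarrow> ('u \<Rightarrow> 'u) \<Rightarrow> 'x \<Rightarrow> 'x"

definition matching_families ::
  "'u ring set \<Rightarrow> ('u, 'x) presheaf \<Rightarrow> 'u ring \<Rightarrow> 'u arrow set \<Rightarrow> ('u arrow \<Rightarrow> 'x) set"
  where "matching_families C F A R =
    {s \<in> (\<Pi>\<^sub>E m\<in>R. sect F (fst m)).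
      \<forall>(B, f)\<in>R. \<forall>(B', f')\<in>R. \<forall>P p q. is_pushout C A B f B' f' P p q \<longrightarrow>
        res F B P p (s (B, f)) = res F B' P q (s (B', f'))}"

definition local_sections ::
  "'u ring set \<Rightarrow> 'u coverings \<Rightarrow> ('u, 'x) presheaf \<Rightarrow> 'u ring
    \<Rightarrow> ('u arrow set \<times> ('u arrow \<Rightarrow> 'x)) set"
  where "local_sections C Cov F A = {(R, s). R \<in> Cov A \<and> s \<in> matching_families C F A R}"

text \<open>
  Let \<open>g : A -> A'\<close>. A matching family \<open>(R, s)\<close> over A is related to a matching family
  \<open>(R', s')\<close> over A' if the pullback of \<open>(R, s)\<close> along \<open>g\<close> and \<open>(R', s')\<close> become equal on a
  common refinement \<open>T\<close>. For the identity this is the equivalence relation defining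
  the colimit of the sets of matching families over all coverings; for general
  \<open>g\<close> it is the graph, on representatives, of the restriction map between the colimits.
\<close>

definition locally_agree ::
  "'u ring set \<Rightarrow> 'u coverings \<Rightarrow> ('u, 'x) presheaf \<Rightarrow> 'u ring \<Rightarrow> 'u ring \<Rightarrow> ('u \<Rightarrow> 'u)
    \<Rightarrow> (('u arrow set \<times> ('u arrow \<Rightarrow> 'x)) \<times> ('u arrow set \<times> ('u arrow \<Rightarrow> 'x))) set"
  where "locally_agree C Cov F A A' g =
    {((R, s), (R', s')).
      (R, s) \<in> local_sections C Cov F A \<and> (R', s') \<in> local_sections C Cov F A' \<and>
      (\<exists>T\<in>Cov A'. \<forall>(D, k)\<in>T. \<exists>(B, f)\<in>R. \<exists>(B', f')\<in>R'. \<exists>h\<in>rhom B D. \<exists>h'\<in>rhom B' D.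
        compose (carrier A) h f = compose (carrier A) k g \<and>
        compose (carrier A') h' f' = k \<and>
        res F B D h (s (B, f)) = res F B' D h' (s' (B', f')))}"

definition plus ::
  "'u ring set \<Rightarrow> 'u coverings \<Rightarrow> ('u, 'x) presheaf
    \<Rightarrow> ('u, ('u arrow set \<times> ('u arrow \<Rightarrow> 'x)) set) presheaf"
  where "plus C Cov F =
    \<lparr> sect = (\<lambda>A. local_sections C Cov F A // locally_agree C Cov F A A (rid A)),
      res = (\<lambda>A A' g X. locally_agree C Cov F A A' g `` X) \<rparr>"

text \<open>
  A morphism of presheaves F -> G is given by its components \<open>t A\<close>. The morphism which it induces
  on the plus constructions only depends on F through \<open>t\<close>.
\<close>

definition plus_map ::
  "'u ring set \<Rightarrow> 'u coverings \<Rightarrow> ('u, 'y) presheaf \<Rightarrow> ('u ring \<Rightarrow> 'x \<Rightarrow> 'y)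
    \<Rightarrow> 'u ring \<Rightarrow> ('u arrow set \<times> ('u arrow \<Rightarrow> 'x)) set
    \<Rightarrow> ('u arrow set \<times> ('u arrow \<Rightarrow> 'y)) set"
  where "plus_map C Cov G t A X =
    locally_agree C Cov G A A (rid A) `` ((\<lambda>(R, s). (R, \<lambda>m\<in>R. t (fst m) (s m))) ` X)"

definition sheafify ::
  "'u ring set \<Rightarrow> 'u coverings \<Rightarrow> ('u, 'x) presheaf
    \<Rightarrow> ('u, ('u arrow set \<times> ('u arrow \<Rightarrow> ('u arrow set \<times> ('u arrow \<Rightarrow> 'x)) set)) set) presheaf"
  where "sheafify C Cov F = plus C Cov (plus C Cov F)"

definition sheafify_map ::
  "'u ring set \<Rightarrow> 'u coverings \<Rightarrow> ('u, 'y) presheaf \<Rightarrow> ('u ring \<Rightarrow> 'x \<Rightarrow> 'y)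
    \<Rightarrow> 'u ring \<Rightarrow> ('u arrow set \<times> ('u arrow \<Rightarrow> ('u arrow set \<times> ('u arrow \<Rightarrow> 'x)) set)) set
    \<Rightarrow> ('u arrow set \<times> ('u arrow \<Rightarrow> ('u arrow set \<times> ('u arrow \<Rightarrow> 'y)) set)) set"
  where "sheafify_map C Cov G t = plus_map C Cov (plus C Cov G) (plus_map C Cov G t)"


section \<open>The reduced monoid ring\<close>

definition monoid_ring :: "'u ring \<Rightarrow> ('u \<Rightarrow>\<^sub>0 int) ring"
  where "monoid_ring A =
    \<lparr> carrier = {x. Poly_Mapping.keys x \<subseteq> carrier A},
      mult = (\<lambda>x y. frag_extend (\<lambda>a. frag_extend (\<lambda>b. frag_of (a \<otimes>\<^bsub>A\<^esub> b)) y) x),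
      one = frag_of \<one>\<^bsub>A\<^esub>,
      ring.zero = 0,
      add = (+) \<rparr>"

definition zero_ideal :: "'u ring \<Rightarrow> ('u \<Rightarrow>\<^sub>0 int) set"
  where "zero_ideal A = range (\<lambda>n. frag_cmul n (frag_of \<zero>\<^bsub>A\<^esub>))"

definition reduced_monoid_ring :: "'u ring \<Rightarrow> ('u \<Rightarrow>\<^sub>0 int) set ring"
  where "reduced_monoid_ring A = monoid_ring A Quot zero_ideal A"

definition reduced_monoid_ring_map ::
  "'u ring \<Rightarrow> ('u \<Rightarrow> 'u) \<Rightarrow> ('u \<Rightarrow>\<^sub>0 int) set \<Rightarrow> ('u \<Rightarrow>\<^sub>0 int) set"
  where "reduced_monoid_ring_map B f X =
    the_elem ((\<lambda>x. zero_ideal B +>\<^bsub>monoid_ring B\<^esub> frag_extend (\<lambda>a. frag_of (f a)) x) ` X)"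

definition reduced_monoid_presheaf :: "('u, ('u \<Rightarrow>\<^sub>0 int) set) presheaf"
  where "reduced_monoid_presheaf =
    \<lparr> sect = (\<lambda>A. carrier (reduced_monoid_ring A)),
      res = (\<lambda>A B f. reduced_monoid_ring_map B f) \<rparr>"


section \<open>Rational Witt vectors\<close>

text \<open>
  Power series are represented by their coefficient sequences. The structure below is the additive
  group of the Witt ring W(A), whose operation is multiplication of power series. The
  Witt product is not needed: a homomorphism out of \<open>\<int>A\<close> that extends a given
  map on the basis is determined by additivity.
\<close>

definition witt_group :: "'u ring \<Rightarrow> (nat \<Rightarrow> 'u) monoid"
  where "witt_group A =
    \<lparr> carrier = {w \<in> UNIV \<rightarrow> carrier A. w 0 = \<one>\<^bsub>A\<^esub>},
      mult = (\<lambda>v w n. \<Oplus>\<^bsub>A\<^esub>i\<in>{..n}. v i \<otimes>\<^bsub>A\<^esub> w (n - i)),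
      one = (\<lambda>n. if n = 0 then \<one>\<^bsub>A\<^esub> else \<zero>\<^bsub>A\<^esub>) \<rparr>"

text \<open>\<^term>\<open>up A\<close> is the set of polynomials.\<close>

definition W_rat :: "'u ring \<Rightarrow> (nat \<Rightarrow> 'u) set"
  where "W_rat A =
    {P \<otimes>\<^bsub>witt_group A\<^esub> (inv\<^bsub>witt_group A\<^esub> Q) | P Q.
      P \<in> carrier (witt_group A) \<inter> up A \<and> Q \<in> carrier (witt_group A) \<inter> up A}"

definition W_rat_presheaf :: "('u, nat \<Rightarrow> 'u) presheaf"
  where "W_rat_presheaf = \<lparr> sect = W_rat, res = (\<lambda>A B f w. f \<circ> w) \<rparr>"

definition teich :: "'u ring \<Rightarrow> 'u \<Rightarrow> nat \<Rightarrow> 'u"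
  where "teich A a n =
    (if n = 0 then \<one>\<^bsub>A\<^esub> else if n = 1 then \<ominus>\<^bsub>A\<^esub> a else \<zero>\<^bsub>A\<^esub>)"

text \<open>
  The map \<open>\<int>A -> W(A)\<close> sends \<open>\<Sum> n\<^sub>a (a)\<close> to the Witt sum of the \<open>n\<^sub>a [a]\<close>, that is,
  to the power series \<open>\<Prod> (1 - aT)^n\<^sub>a\<close>. It is trivial on \<open>(0)\<close>, hence constant on cosets.
\<close>

definition omega_monoid_ring :: "'u ring \<Rightarrow> ('u \<Rightarrow>\<^sub>0 int) \<Rightarrow> nat \<Rightarrow> 'u"
  where "omega_monoid_ring A x =
    (\<Otimes>\<^bsub>witt_group A\<^esub>a\<in>Poly_Mapping.keys x.
      teich A a [^]\<^bsub>witt_group A\<^esub> Poly_Mapping.lookup x a)"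

definition omega :: "'u ring \<Rightarrow> ('u \<Rightarrow>\<^sub>0 int) set \<Rightarrow> nat \<Rightarrow> 'u"
  where "omega A X = the_elem (omega_monoid_ring A ` X)"

end

theory Submission
  imports Defs
begin

text \<open>
  Injectivity of \<open>\<omega>\<close> for a domain \<open>B\<close>: if \<open>\<Prod>(1 - aT)^n\<^sub>a = 1\<close> and \<open>n\<^sub>c \<noteq> 0\<close> for some
  \<open>c \<noteq> 0\<close>, then separating positive from negative exponents gives an equality of polynomials in
  which \<open>1 - cT\<close> divides exactly one side; over the fraction field this contradicts evaluation at
  \<open>T = 1/c\<close>. For a general site, two sections of the sheafification with equal image are
  represented, after passing to a covering twice (once for each plus construction), by sections of
  \<open>\<int>(\<O>)\<close> that \<open>\<omega>\<close> identifies on every member. Refining that covering by domains they become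
  equal, and equality on a covering is equality in the sheafification.
\<close>

section \<open>Local agreement of matching families\<close>

text \<open>Domains are available only as refinements of coverings of \<open>A\<close> itself,
  whereas unwinding the inner plus construction yields coverings of the members of a covering of
  \<open>A\<close>, over which nothing is assumed. The local comparison is therefore stated for
  every further base change along which the component of the morphism is injective. All coverings
  are composed to a single covering of \<open>A\<close> before any domain is chosen, and the
  refinement by domains takes place there.

  On the algebraic side the point \<open>1/c\<close> exists only for \<open>c \<noteq> 0\<close>.
  The remaining basis element is \<open>(0)\<close>: its image \<open>1 - 0T = 1\<close> is the zero
  of the Witt ring, so it lies in the kernel for every ring, and it is exactly what the reduced
  monoid ring divides out. The separation of positive from negative exponents is done by group
  theory: the fractions of polynomials that do not vanish at \<open>1/c\<close> form a subgroup,
  which contains \<open>1 - aT\<close> for all \<open>a \<noteq> c\<close> but no positive power of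
  \<open>1 - cT\<close>.\<close>

lemma rhom_closed: "f \<in> rhom A B \<Longrightarrow> x \<in> carrier A \<Longrightarrow> f x \<in> carrier B"
  by (auto simp: rhom_def ring_hom_def)

lemma rid_rhom:
  assumes "ring A"
  shows "rid A \<in> rhom A A"
proof -
  interpret ring A by fact
  show ?thesis by (auto simp: rhom_def ring_hom_def rid_def)
qed

lemma rhom_compose:
  assumes "ring A" "f \<in> rhom A B" "g \<in> rhom B D"
  shows "compose (carrier A) g f \<in> rhom A D"
proof -
  interpret ring A by fact
  show ?thesis using assms(2,3) by (auto simp: rhom_def ring_hom_def compose_def Pi_iff)
qed

lemma compose_eq_iff:
  "compose S h f = compose S k g \<longleftrightarrow> (\<forall>x\<in>S. h (f x) = k (g x))"
  by (auto simp: compose_def restrict_def fun_eq_iff)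

lemma compose_eq_rhom_iff:
  "k \<in> rhom A D \<Longrightarrow> compose (carrier A) h f = k \<longleftrightarrow> (\<forall>x\<in>carrier A. h (f x) = k x)"
  by (auto simp: rhom_def compose_def restrict_def extensional_def fun_eq_iff)

lemma compose_at:
  "f \<in> rhom A B \<Longrightarrow> x \<in> carrier A \<Longrightarrow> compose (carrier B) h g (f x) = h (g (f x))"
  by (simp add: compose_eq rhom_closed)

lemma compose_rid: "f \<in> rhom A B \<Longrightarrow> compose (carrier A) f (rid A) = f"
  by (simp add: compose_eq_rhom_iff rid_def)

lemma rid_compose: "f \<in> rhom A B \<Longrightarrow> compose (carrier A) (rid B) f = f"
  by (auto simp: compose_eq_rhom_iff rid_def rhom_closed)

section \<open>Coverings: base change and common refinement\<close>

locale ring_site = pretopology C Cov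
  for C :: "'u ring set" and Cov :: "'u coverings" +
  assumes ringC: "A \<in> C \<Longrightarrow> ring A"
begin

lemma rid_in: "A \<in> C \<Longrightarrow> rid A \<in> rhom A A"
  by (simp add: rid_rhom ringC)

lemma comp_in:
  "A \<in> C \<Longrightarrow> f \<in> rhom A B \<Longrightarrow> g \<in> rhom B D \<Longrightarrow> compose (carrier A) g f \<in> rhom A D"
  by (simp add: rhom_compose ringC)

lemma identity_cover:
  assumes A: "A \<in> C"
  shows "{(A, rid A)} \<in> Cov A"
proof (rule iso)
  show "rid A \<in> ring_iso A A"
    using rid_in[OF A] by (auto simp: ring_iso_def rhom_def rid_def bij_betw_def inj_on_def)
qed (use A in \<open>auto intro: rid_in\<close>)

lemma pullback_cover:
  assumes "A \<in> C" "R \<in> Cov A" "A' \<in> C" "g \<in> rhom A A'"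
  shows "\<exists>R'\<in>Cov A'. \<forall>(P, p)\<in>R'. \<exists>(B, f)\<in>R. \<exists>q\<in>rhom B P.
    compose (carrier A) p g = compose (carrier A) q f"
proof -
  \<comment> \<open>The axiom \<open>base_change\<close> expects the fibre products and their
    projections to \<open>A'\<close> as functions of the member, so they are chosen here; the other
    projection \<open>q\<close> may stay existential.\<close>
  have "\<forall>m. \<exists>P p. m \<in> R \<longrightarrow> (\<exists>q. is_pushout C A A' g (fst m) (snd m) P p q)"
    using base_change_exists[OF assms(1,2) _ assms(3,4)] by (metis prod.collapse)
  then obtain P p where
    *: "\<And>m. m \<in> R \<Longrightarrow> \<exists>q. is_pushout C A A' g (fst m) (snd m) (P m) (p m) q"
    by metis
  have cov: "(\<lambda>m. (P m, p m)) ` R \<in> Cov A'"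
    by (rule base_change[OF assms]) (use * in force)
  have "\<exists>(B, f)\<in>R. \<exists>q\<in>rhom B (P m).
      compose (carrier A) (p m) g = compose (carrier A) q f" if "m \<in> R" for m
    using *[OF that] that by (cases m) (auto simp: is_pushout_def)
  then have *: "case (P m, p m) of (P, p) \<Rightarrow> \<exists>(B, f)\<in>R. \<exists>q\<in>rhom B P.
      compose (carrier A) p g = compose (carrier A) q f" if "m \<in> R" for m
    using that by simp
  show ?thesis
  proof (rule bexI[OF _ cov], rule ballI)
    fix x assume "x \<in> (\<lambda>m. (P m, p m)) ` R"
    then obtain m where m: "m \<in> R" "x = (P m, p m)" by blast
    show "case x of (P, p) \<Rightarrow> \<exists>(B, f)\<in>R. \<exists>q\<in>rhom B P.
        compose (carrier A) p g = compose (carrier A) q f"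
      unfolding m(2) by (rule *[OF m(1)])
  qed
qed

text \<open>Pulling \<open>R'\<close> back to each member of \<open>R\<close> and composing the
  resulting coverings with \<open>R\<close> gives a covering whose members factor through both. The
  maps out of members of \<open>R\<close> are the structure maps of the pulled back coverings; those
  out of members of \<open>R'\<close> come from the commuting squares.\<close>

lemma common_refinement:
  assumes "A \<in> C" "R \<in> Cov A" "R' \<in> Cov A"
  shows "\<exists>U\<in>Cov A. \<forall>(D, k)\<in>U. \<exists>(B, f)\<in>R. \<exists>(B', f')\<in>R'. \<exists>h\<in>rhom B D. \<exists>h'\<in>rhom B' D.
    compose (carrier A) h f = k \<and> compose (carrier A) h' f' = k"
proof -
  let ?P = "\<lambda>m S. S \<in> Cov (fst m) \<and> (\<forall>(P, p)\<in>S. \<exists>(B, f)\<in>R'. \<exists>q\<in>rhom B P.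
      compose (carrier A) p (snd m) = compose (carrier A) q f)"
  have "\<exists>S. ?P m S" if "m \<in> R" for m
  proof -
    have "fst m \<in> C" "snd m \<in> rhom A (fst m)"
      using family[OF assms(1,2), of "fst m" "snd m"] that by simp_all
    then show ?thesis using pullback_cover[OF assms(1,3)] by blast
  qed
  then have "\<forall>m\<in>R. \<exists>S. ?P m S" by blast
  then obtain S where S0: "\<forall>m\<in>R. ?P m (S m)" by (rule bchoice[THEN exE])
  then have S: "\<And>m. m \<in> R \<Longrightarrow> S m \<in> Cov (fst m)" by blast
  have S': "\<exists>(B, f)\<in>R'. \<exists>q\<in>rhom B P. compose (carrier A) p (snd m) = compose (carrier A) q f"
    if "m \<in> R" "(P, p) \<in> S m" for m P p
    using S0 that by blast
  let ?U = "{(D, compose (carrier A) g f) | B f D g. (B, f) \<in> R \<and> (D, g) \<in> S (B, f)}"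
  have cov: "?U \<in> Cov A"
    by (rule composition[OF assms(1,2)]) (use S in force)
  have *: "\<exists>(B', f')\<in>R. \<exists>(B'', f'')\<in>R'. \<exists>h\<in>rhom B' D. \<exists>h'\<in>rhom B'' D.
      compose (carrier A) h f' = compose (carrier A) g f
      \<and> compose (carrier A) h' f'' = compose (carrier A) g f"
    if m: "(B, f) \<in> R" "(D, g) \<in> S (B, f)" for B f D g
  proof -
    have "g \<in> rhom B D"
      using family[OF assms(1,2) m(1)] S[OF m(1)] m(2) family[of B "S (B, f)" D g] by auto
    then show ?thesis using S'[OF m] m(1) by fastforce
  qed
  show ?thesis
  proof (rule bexI[OF _ cov], rule ballI)
    fix m assume "m \<in> ?U"
    then obtain B f D g where m: "m = (D, compose (carrier A) g f)" "(B, f) \<in> R" "(D, g) \<in> S (B, f)"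
      by blast
    show "case m of (D, k) \<Rightarrow> \<exists>(B, f)\<in>R. \<exists>(B', f')\<in>R'. \<exists>h\<in>rhom B D. \<exists>h'\<in>rhom B' D.
      compose (carrier A) h f = k \<and> compose (carrier A) h' f' = k"
      unfolding m(1) prod.case by (rule *[OF m(2,3)])
  qed
qed

end

section \<open>Matching families of a presheaf\<close>

locale presheaf_on = ring_site C Cov
  for C :: "'u ring set" and Cov :: "'u coverings" +
  fixes F :: "('u, 'x) presheaf"
  assumes res_closed:
      "A \<in> C \<Longrightarrow> B \<in> C \<Longrightarrow> f \<in> rhom A B \<Longrightarrow> x \<in> sect F A \<Longrightarrow> res F A B f x \<in> sect F B"
    and res_id: "A \<in> C \<Longrightarrow> x \<in> sect F A \<Longrightarrow> res F A A (rid A) x = x"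
    and res_comp:
      "A \<in> C \<Longrightarrow> B \<in> C \<Longrightarrow> D \<in> C \<Longrightarrow> f \<in> rhom A B \<Longrightarrow> g \<in> rhom B D \<Longrightarrow> x \<in> sect F A \<Longrightarrow>
        res F B D g (res F A B f x) = res F A D (compose (carrier A) g f) x"
begin

abbreviation LS where "LS \<equiv> local_sections C Cov F"

abbreviation LA where "LA \<equiv> locally_agree C Cov F"

lemma matching_sect: "s \<in> matching_families C F A R \<Longrightarrow> (B, f) \<in> R \<Longrightarrow> s (B, f) \<in> sect F B"
  by (force simp: matching_families_def PiE_iff)

text \<open>The definition compares two members on their fibre product only. Compatible maps into
  any \<open>D\<close> factor through the pushout, so the equality is carried to \<open>D\<close> by
  restriction. In this form the matching condition can be applied to whatever ring is at
  hand.\<close>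

lemma matching_agree:
  assumes "A \<in> C" "R \<in> Cov A" "s \<in> matching_families C F A R" "(B, f) \<in> R" "(B', f') \<in> R"
    and "D \<in> C" "h \<in> rhom B D" "h' \<in> rhom B' D"
    and "compose (carrier A) h f = compose (carrier A) h' f'"
  shows "res F B D h (s (B, f)) = res F B' D h' (s (B', f'))"
proof -
  note m = family[OF assms(1,2,4)] family[OF assms(1,2,5)]
  obtain P p q where P: "is_pushout C A B f B' f' P p q"
    using base_change_exists[OF assms(1,2,5), of B f] m by auto
  then obtain w where w: "w \<in> rhom P D" "compose (carrier B) w p = h" "compose (carrier B') w q = h'"
    using assms(6-9) unfolding is_pushout_def by meson
  have PC: "P \<in> C" "p \<in> rhom B P" "q \<in> rhom B' P" using P by (auto simp: is_pushout_def)
  have "res F B P p (s (B, f)) = res F B' P q (s (B', f'))"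
    using assms(3-5) P unfolding matching_families_def by fast
  then show ?thesis
    using res_comp[of B P D p w "s (B, f)"] res_comp[of B' P D q w "s (B', f')"] m PC w assms(6)
      matching_sect[OF assms(3,4)] matching_sect[OF assms(3,5)] by simp
qed

text \<open>A pushout with its two maps is itself one of the test objects \<open>D\<close>.\<close>

lemma matching_agreeI:
  assumes "s \<in> (\<Pi>\<^sub>E m\<in>R. sect F (fst m))"
    and "\<And>B f B' f' D h h'. \<lbrakk>(B, f) \<in> R; (B', f') \<in> R; D \<in> C; h \<in> rhom B D; h' \<in> rhom B' D;
      compose (carrier A) h f = compose (carrier A) h' f'\<rbrakk>
      \<Longrightarrow> res F B D h (s (B, f)) = res F B' D h' (s (B', f'))"
  shows "s \<in> matching_families C F A R"
proof -
  have "res F B P p (s (B, f)) = res F B' P q (s (B', f'))"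
    if "(B, f) \<in> R" "(B', f') \<in> R" "is_pushout C A B f B' f' P p q" for B f B' f' P p q
    using assms(2)[OF that(1,2), of P p q] that(3) unfolding is_pushout_def by blast
  then show ?thesis using assms(1) unfolding matching_families_def by blast
qed

text \<open>\<open>LA_I\<close> and \<open>LA_E\<close> replace the nested bounded quantifiers over
  pairs in \<open>locally_agree\<close> by one plain existential statement.\<close>

lemma LA_I:
  assumes "(R, s) \<in> LS A" "(R', s') \<in> LS A'" "T \<in> Cov A'"
    and "\<And>D k. (D, k) \<in> T \<Longrightarrow> \<exists>B f B' f' h h'. (B, f) \<in> R \<and> (B', f') \<in> R'
      \<and> h \<in> rhom B D \<and> h' \<in> rhom B' D
      \<and> compose (carrier A) h f = compose (carrier A) k g
      \<and> compose (carrier A') h' f' = k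
      \<and> res F B D h (s (B, f)) = res F B' D h' (s' (B', f'))"
  shows "((R, s), (R', s')) \<in> LA A A' g"
proof -
  have "\<forall>(D, k)\<in>T. \<exists>(B, f)\<in>R. \<exists>(B', f')\<in>R'. \<exists>h\<in>rhom B D. \<exists>h'\<in>rhom B' D.
        compose (carrier A) h f = compose (carrier A) k g \<and>
        compose (carrier A') h' f' = k \<and>
        res F B D h (s (B, f)) = res F B' D h' (s' (B', f'))"
    using assms(4) by fast
  then show ?thesis using assms(1-3) unfolding locally_agree_def by blast
qed

lemma LA_E:
  assumes "((R, s), (R', s')) \<in> LA A A' g"
  obtains T where "(R, s) \<in> LS A" "(R', s') \<in> LS A'" "T \<in> Cov A'"
    "\<And>D k. (D, k) \<in> T \<Longrightarrow> \<exists>B f B' f' h h'. (B, f) \<in> R \<and> (B', f') \<in> R'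
      \<and> h \<in> rhom B D \<and> h' \<in> rhom B' D
      \<and> compose (carrier A) h f = compose (carrier A) k g
      \<and> compose (carrier A') h' f' = k
      \<and> res F B D h (s (B, f)) = res F B' D h' (s' (B', f'))"
proof -
  obtain T where T: "(R, s) \<in> LS A" "(R', s') \<in> LS A'" "T \<in> Cov A'"
     "\<forall>(D, k)\<in>T. \<exists>(B, f)\<in>R. \<exists>(B', f')\<in>R'. \<exists>h\<in>rhom B D. \<exists>h'\<in>rhom B' D.
        compose (carrier A) h f = compose (carrier A) k g \<and>
        compose (carrier A') h' f' = k \<and>
        res F B D h (s (B, f)) = res F B' D h' (s' (B', f'))"
    using assms unfolding locally_agree_def by blast
  show thesis by (rule that[OF T(1-3)]) (use T(4) in fast)
qed

lemma LS_D:
  assumes "(R, s) \<in> LS A"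
  shows "R \<in> Cov A" "s \<in> matching_families C F A R"
  using assms by (auto simp: local_sections_def)

lemma LA_subset: "LA A A' g \<subseteq> LS A \<times> LS A'"
  unfolding locally_agree_def by auto

section \<open>Local agreement: equivalence relation and graph of restriction\<close>

lemma LA_refl:
  assumes "A \<in> C" "x \<in> LS A"
  shows "(x, x) \<in> LA A A (rid A)"
proof -
  obtain R s where x: "x = (R, s)" by force
  have R: "R \<in> Cov A" using assms(2) x LS_D by simp
  show ?thesis unfolding x
  proof (rule LA_I[where T = R])
    fix D k assume m: "(D, k) \<in> R"
    then have k: "k \<in> rhom A D" and fam: "D \<in> C"
      using family[OF assms(1) R] by auto
    show "\<exists>B f B' f' h h'. (B, f) \<in> R \<and> (B', f') \<in> R \<and> h \<in> rhom B D \<and> h' \<in> rhom B' D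
      \<and> compose (carrier A) h f = compose (carrier A) k (rid A)
      \<and> compose (carrier A) h' f' = k
      \<and> res F B D h (s (B, f)) = res F B' D h' (s (B', f'))"
      by (rule exI[of _ D], rule exI[of _ k], rule exI[of _ D], rule exI[of _ k],
          rule exI[of _ "rid D"], rule exI[of _ "rid D"])
        (use m k in \<open>simp add: rid_in fam compose_rid rid_compose\<close>)
  qed (use assms x R in auto)
qed

lemma LA_sym:
  assumes "A \<in> C" "(x, y) \<in> LA A A (rid A)"
  shows "(y, x) \<in> LA A A (rid A)"
proof -
  obtain R s where x: "x = (R, s)" by force
  obtain R' s' where y: "y = (R', s')" by force
  obtain T where T: "(R, s) \<in> LS A" "(R', s') \<in> LS A" "T \<in> Cov A"
    "\<And>D k. (D, k) \<in> T \<Longrightarrow> \<exists>B f B' f' h h'. (B, f) \<in> R \<and> (B', f') \<in> R'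
      \<and> h \<in> rhom B D \<and> h' \<in> rhom B' D
      \<and> compose (carrier A) h f = compose (carrier A) k (rid A)
      \<and> compose (carrier A) h' f' = k
      \<and> res F B D h (s (B, f)) = res F B' D h' (s' (B', f'))"
    using LA_E[OF assms(2)[unfolded x y]] by blast
  show ?thesis unfolding x y
  proof (rule LA_I[OF T(2,1,3)])
    fix D k assume m: "(D, k) \<in> T"
    then have k: "compose (carrier A) k (rid A) = k"
      using family[OF assms(1) T(3)] compose_rid by blast
    obtain B f B' f' h h' where *: "(B, f) \<in> R" "(B', f') \<in> R'" "h \<in> rhom B D" "h' \<in> rhom B' D"
      "compose (carrier A) h f = k" "compose (carrier A) h' f' = k"
      "res F B D h (s (B, f)) = res F B' D h' (s' (B', f'))"
      using T(4)[OF m] unfolding k by auto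
    show "\<exists>B f B' f' h h'. (B, f) \<in> R' \<and> (B', f') \<in> R \<and> h \<in> rhom B D \<and> h' \<in> rhom B' D
      \<and> compose (carrier A) h f = compose (carrier A) k (rid A)
      \<and> compose (carrier A) h' f' = k
      \<and> res F B D h (s' (B, f)) = res F B' D h' (s (B', f'))"
      unfolding k
      by (rule exI[of _ B'], rule exI[of _ f'], rule exI[of _ B], rule exI[of _ f], rule exI[of _ h'],
        rule exI[of _ h]) (simp add: *)
  qed
qed

text \<open>For identities this is transitivity of the equivalence, in general it is functoriality
  of restriction. The covering that witnesses the first relation is pulled back along
  \<open>g'\<close> and refined together with the one that witnesses the second. On a member of the
  result both relations involve the middle family \<open>s'\<close>, but possibly at two different
  members of \<open>R'\<close>; \<open>matching_agree\<close> identifies the two values.\<close>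

lemma LA_trans:
  assumes C: "A \<in> C" "A' \<in> C" "A'' \<in> C" and g: "g \<in> rhom A A'" "g' \<in> rhom A' A''"
    and xy: "(x, y) \<in> LA A A' g" and yz: "(y, z) \<in> LA A' A'' g'"
  shows "(x, z) \<in> LA A A'' (compose (carrier A) g' g)"
proof -
  obtain R s where x: "x = (R, s)" by force
  obtain R' s' where y: "y = (R', s')" by force
  obtain R'' s'' where z: "z = (R'', s'')" by force
  obtain T where T: "(R, s) \<in> LS A" "(R', s') \<in> LS A'" "T \<in> Cov A'"
    "\<And>D k. (D, k) \<in> T \<Longrightarrow> \<exists>B f B' f' h h'. (B, f) \<in> R \<and> (B', f') \<in> R'
      \<and> h \<in> rhom B D \<and> h' \<in> rhom B' D
      \<and> compose (carrier A) h f = compose (carrier A) k g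
      \<and> compose (carrier A') h' f' = k
      \<and> res F B D h (s (B, f)) = res F B' D h' (s' (B', f'))"
    using LA_E[OF xy[unfolded x y]] by blast
  obtain T' where T': "(R'', s'') \<in> LS A''" "T' \<in> Cov A''"
    "\<And>D k. (D, k) \<in> T' \<Longrightarrow> \<exists>B f B' f' h h'. (B, f) \<in> R' \<and> (B', f') \<in> R''
      \<and> h \<in> rhom B D \<and> h' \<in> rhom B' D
      \<and> compose (carrier A') h f = compose (carrier A') k g'
      \<and> compose (carrier A'') h' f' = k
      \<and> res F B D h (s' (B, f)) = res F B' D h' (s'' (B', f'))"
    using LA_E[OF yz[unfolded y z]] by blast
  obtain T2 where T2: "T2 \<in> Cov A''" "\<forall>(P, p)\<in>T2. \<exists>(B, f)\<in>T. \<exists>q\<in>rhom B P.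
      compose (carrier A') p g' = compose (carrier A') q f"
    using pullback_cover[OF C(2) T(3) C(3) g(2)] by blast
  obtain U where U: "U \<in> Cov A''"
    "\<forall>(D, k)\<in>U. \<exists>(B, f)\<in>T2. \<exists>(B', f')\<in>T'. \<exists>h\<in>rhom B D. \<exists>h'\<in>rhom B' D.
      compose (carrier A'') h f = k \<and> compose (carrier A'') h' f' = k"
    using common_refinement[OF C(3) T2(1) T'(2)] by blast
  note ms = LS_D[OF T(1)] LS_D[OF T(2)] LS_D[OF T'(1)]
  show ?thesis unfolding x z
  proof (rule LA_I[OF T(1) T'(1) U(1)])
    fix D k assume Dk: "(D, k) \<in> U"
    then have D: "D \<in> C" "k \<in> rhom A'' D" using family[OF C(3) U(1)] by auto
    obtain D2 k2 D' k' u v where u: "(D2, k2) \<in> T2" "(D', k') \<in> T'" "u \<in> rhom D2 D" "v \<in> rhom D' D"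
      "compose (carrier A'') u k2 = k" "compose (carrier A'') v k' = k"
      using U(2) Dk by fast
    then obtain E l q where q: "(E, l) \<in> T" "q \<in> rhom E D2"
      "compose (carrier A') k2 g' = compose (carrier A') q l"
      using T2(2) by fast
    obtain B f B' f' h h' where h: "(B, f) \<in> R" "(B', f') \<in> R'" "h \<in> rhom B E" "h' \<in> rhom B' E"
      "compose (carrier A) h f = compose (carrier A) l g"
      "compose (carrier A') h' f' = l"
      "res F B E h (s (B, f)) = res F B' E h' (s' (B', f'))"
      using T(4)[OF q(1)] by blast
    obtain B1 f1 B2 f2 h1 h2 where h1: "(B1, f1) \<in> R'" "(B2, f2) \<in> R''"
      "h1 \<in> rhom B1 D'" "h2 \<in> rhom B2 D'"
      "compose (carrier A') h1 f1 = compose (carrier A') k' g'"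
      "compose (carrier A'') h2 f2 = k'"
      "res F B1 D' h1 (s' (B1, f1)) = res F B2 D' h2 (s'' (B2, f2))"
      using T'(3)[OF u(2)] by blast
    note fam = family[OF C(3) T2(1) u(1)] family[OF C(3) T'(2) u(2)] family[OF C(2) T(3) q(1)]
      family[OF C(1) ms(1) h(1)] family[OF C(2) ms(3) h(2)] family[OF C(2) ms(3) h1(1)]
      family[OF C(3) ms(5) h1(2)]
    \<comment> \<open>The composite \<open>E -> D2 -> D\<close> transports the data of the first
      relation, given over \<open>E\<close>, to the common refinement.\<close>
    define uq where "uq = compose (carrier E) u q"
    have uq: "uq \<in> rhom E D" using comp_in[OF _ q(2) u(3)] fam by (simp add: uq_def)
    have uq1: "uq (l a) = k (g' a)" if "a \<in> carrier A'" for a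
    proof -
      have "uq (l a) = u (q (l a))"
        using fam rhom_closed that by (metis uq_def compose_eq)
      also have "\<dots> = u (k2 (g' a))" using q(3) that by (simp add: compose_eq_iff)
      also have "\<dots> = k (g' a)" using u(5) g(2) that rhom_closed D(2)
        by (metis compose_eq)
      finally show ?thesis .
    qed
    have v1: "v (k' a) = k a" if "a \<in> carrier A''" for a
      using u(6) that by (metis compose_eq)
    have p1: "compose (carrier A) (compose (carrier B) uq h) f
        = compose (carrier A) k (compose (carrier A) g' g)"
    proof -
      have "uq (h (f a)) = k (g' (g a))" if "a \<in> carrier A" for a
        using h(5) uq1[of "g a"] that g(1) rhom_closed by (metis compose_eq_iff)
      then show ?thesis
        using fam by (auto simp: compose_eq_iff compose_at compose_eq)
    qed
    have p2: "compose (carrier A'') (compose (carrier B2) v h2) f2 = k"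
    proof -
      have "v (h2 (f2 a)) = k a" if "a \<in> carrier A''" for a
        using v1 that h1(6) by (metis compose_eq)
      then show ?thesis
        using fam by (auto simp: compose_eq_rhom_iff[OF D(2)] compose_at)
    qed
    \<comment> \<open>Both routes from \<open>A'\<close> to \<open>D\<close> equal \<open>k\<close>
      after \<open>g'\<close>. This is the compatibility under which \<open>matching_agree\<close>
      exchanges the two values of \<open>s'\<close>.\<close>
    have p3: "compose (carrier A') (compose (carrier B') uq h') f'
      = compose (carrier A') (compose (carrier B1) v h1) f1"
    proof -
      have "uq (h' (f' a)) = v (h1 (f1 a))" if "a \<in> carrier A'" for a
      proof -
        have "uq (h' (f' a)) = uq (l a)" using h(6) that by (metis compose_eq)
        also have "\<dots> = k (g' a)" by (rule uq1[OF that])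
        also have "\<dots> = v (k' (g' a))" using v1 g(2) that rhom_closed by metis
        also have "\<dots> = v (h1 (f1 a))" using h1(5) that by (simp add: compose_eq_iff)
        finally show ?thesis .
      qed
      then show ?thesis
        using fam by (auto simp: compose_eq_iff compose_at compose_eq)
    qed
    have "res F B D (compose (carrier B) uq h) (s (B, f)) = res F E D uq (res F B' E h' (s' (B', f')))"
      using res_comp[of B E D h uq "s (B, f)"] fam D h uq matching_sect[OF ms(2) h(1)] by simp
    also have "\<dots> = res F B' D (compose (carrier B') uq h') (s' (B', f'))"
      using res_comp[of B' E D h' uq] fam D h uq matching_sect[OF ms(4) h(2)] by simp
    also have "\<dots> = res F B1 D (compose (carrier B1) v h1) (s' (B1, f1))"
      by (rule matching_agree[OF C(2) ms(3,4) h(2) h1(1) D(1) _ _ p3])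
        (use h h1 u uq fam comp_in in blast)+
    also have "\<dots> = res F D' D v (res F B2 D' h2 (s'' (B2, f2)))"
      using res_comp[of B1 D' D h1 v "s' (B1, f1)"] fam D h1 u matching_sect[OF ms(4) h1(1)] by simp
    also have "\<dots> = res F B2 D (compose (carrier B2) v h2) (s'' (B2, f2))"
      using res_comp[of B2 D' D h2 v] fam D h1 u matching_sect[OF ms(6) h1(2)] by simp
    finally show "\<exists>B f B' f' h h'. (B, f) \<in> R \<and> (B', f') \<in> R''
      \<and> h \<in> rhom B D \<and> h' \<in> rhom B' D
      \<and> compose (carrier A) h f = compose (carrier A) k (compose (carrier A) g' g)
      \<and> compose (carrier A'') h' f' = k
      \<and> res F B D h (s (B, f)) = res F B' D h' (s'' (B', f'))"
      using h(1,3) h1(2,4) p1 p2 uq u(4) fam comp_in by blast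
  qed
qed

text \<open>This makes restriction of classes well defined. The relation along \<open>g\<close>
  cannot be reversed, so transitivity alone does not give it. On a common refinement of the two
  witnessing coverings, \<open>s'\<close> and \<open>s''\<close> are each compared with a value of
  \<open>s\<close>, and these two values agree because \<open>s\<close> is a matching
  family.\<close>

lemma LA_functional:
  assumes C: "A \<in> C" "A' \<in> C" and g: "g \<in> rhom A A'"
    and xy: "(x, y) \<in> LA A A' g" and xz: "(x, z) \<in> LA A A' g"
  shows "(y, z) \<in> LA A' A' (rid A')"
proof -
  obtain R s where x: "x = (R, s)" by force
  obtain R' s' where y: "y = (R', s')" by force
  obtain R'' s'' where z: "z = (R'', s'')" by force
  obtain T where T: "(R, s) \<in> LS A" "(R', s') \<in> LS A'" "T \<in> Cov A'"
    "\<And>D k. (D, k) \<in> T \<Longrightarrow> \<exists>B f B' f' h h'. (B, f) \<in> R \<and> (B', f') \<in> R'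
      \<and> h \<in> rhom B D \<and> h' \<in> rhom B' D
      \<and> compose (carrier A) h f = compose (carrier A) k g
      \<and> compose (carrier A') h' f' = k
      \<and> res F B D h (s (B, f)) = res F B' D h' (s' (B', f'))"
    using LA_E[OF xy[unfolded x y]] by blast
  obtain T' where T': "(R'', s'') \<in> LS A'" "T' \<in> Cov A'"
    "\<And>D k. (D, k) \<in> T' \<Longrightarrow> \<exists>B f B' f' h h'. (B, f) \<in> R \<and> (B', f') \<in> R''
      \<and> h \<in> rhom B D \<and> h' \<in> rhom B' D
      \<and> compose (carrier A) h f = compose (carrier A) k g
      \<and> compose (carrier A') h' f' = k
      \<and> res F B D h (s (B, f)) = res F B' D h' (s'' (B', f'))"
    using LA_E[OF xz[unfolded x z]] by blast
  obtain U where U: "U \<in> Cov A'"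
    "\<forall>(D, k)\<in>U. \<exists>(B, f)\<in>T. \<exists>(B', f')\<in>T'. \<exists>h\<in>rhom B D. \<exists>h'\<in>rhom B' D.
      compose (carrier A') h f = k \<and> compose (carrier A') h' f' = k"
    using common_refinement[OF C(2) T(3) T'(2)] by blast
  note ms = LS_D[OF T(1)] LS_D[OF T(2)] LS_D[OF T'(1)]
  show ?thesis unfolding y z
  proof (rule LA_I[OF T(2) T'(1) U(1)])
    fix D k assume Dk: "(D, k) \<in> U"
    then have D: "D \<in> C" "k \<in> rhom A' D" using family[OF C(2) U(1)] by auto
    obtain E l E' l' u v where u: "(E, l) \<in> T" "(E', l') \<in> T'" "u \<in> rhom E D" "v \<in> rhom E' D"
      "compose (carrier A') u l = k" "compose (carrier A') v l' = k"
      using U(2) Dk by fast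
    obtain B f B' f' h h' where h: "(B, f) \<in> R" "(B', f') \<in> R'" "h \<in> rhom B E" "h' \<in> rhom B' E"
      "compose (carrier A) h f = compose (carrier A) l g"
      "compose (carrier A') h' f' = l"
      "res F B E h (s (B, f)) = res F B' E h' (s' (B', f'))"
      using T(4)[OF u(1)] by blast
    obtain B1 f1 B2 f2 h1 h2 where h1: "(B1, f1) \<in> R" "(B2, f2) \<in> R''"
      "h1 \<in> rhom B1 E'" "h2 \<in> rhom B2 E'"
      "compose (carrier A) h1 f1 = compose (carrier A) l' g"
      "compose (carrier A') h2 f2 = l'"
      "res F B1 E' h1 (s (B1, f1)) = res F B2 E' h2 (s'' (B2, f2))"
      using T'(3)[OF u(2)] by blast
    note fam = family[OF C(2) T(3) u(1)] family[OF C(2) T'(2) u(2)]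
      family[OF C(1) ms(1) h(1)] family[OF C(2) ms(3) h(2)] family[OF C(1) ms(1) h1(1)]
      family[OF C(2) ms(5) h1(2)]
    have u1: "u (l a) = k a" "v (l' a) = k a" if "a \<in> carrier A'" for a
      using u(5,6) that by (metis compose_eq)+
    have p1: "compose (carrier A') (compose (carrier B') u h') f' = compose (carrier A') k (rid A')"
    proof -
      have "u (h' (f' a)) = k a" if "a \<in> carrier A'" for a
        using u1 that h(6) by (metis compose_eq)
      then show ?thesis unfolding compose_rid[OF D(2)]
        using fam by (auto simp: compose_eq_rhom_iff[OF D(2)] compose_at)
    qed
    have p2: "compose (carrier A') (compose (carrier B2) v h2) f2 = k"
    proof -
      have "v (h2 (f2 a)) = k a" if "a \<in> carrier A'" for a
        using u1 that h1(6) by (metis compose_eq)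
      then show ?thesis
        using fam by (auto simp: compose_eq_rhom_iff[OF D(2)] compose_at)
    qed
    have p3: "compose (carrier A) (compose (carrier B) u h) f
      = compose (carrier A) (compose (carrier B1) v h1) f1"
    proof -
      have "u (h (f a)) = v (h1 (f1 a))" if "a \<in> carrier A" for a
        using u1 that h(5) h1(5) rhom_closed[OF g] by (metis compose_eq_iff)
      then show ?thesis
        using fam by (auto simp: compose_eq_iff compose_at compose_eq)
    qed
    have "res F B' D (compose (carrier B') u h') (s' (B', f')) = res F E D u (res F B E h (s (B, f)))"
      using res_comp[of B' E D h' u "s' (B', f')"] fam D h u matching_sect[OF ms(4) h(2)] by simp
    also have "\<dots> = res F B D (compose (carrier B) u h) (s (B, f))"
      using res_comp[of B E D h u "s (B, f)"] fam D h u matching_sect[OF ms(2) h(1)] by simp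
    also have "\<dots> = res F B1 D (compose (carrier B1) v h1) (s (B1, f1))"
      by (rule matching_agree[OF C(1) ms(1,2) h(1) h1(1) D(1) _ _ p3])
        (use h h1 u fam comp_in in blast)+
    also have "\<dots> = res F E' D v (res F B2 E' h2 (s'' (B2, f2)))"
      using res_comp[of B1 E' D h1 v "s (B1, f1)"] fam D h1 u matching_sect[OF ms(2) h1(1)] by simp
    also have "\<dots> = res F B2 D (compose (carrier B2) v h2) (s'' (B2, f2))"
      using res_comp[of B2 E' D h2 v] fam D h1 u matching_sect[OF ms(6) h1(2)] by simp
    finally show "\<exists>B f B' f' h h'. (B, f) \<in> R' \<and> (B', f') \<in> R''
      \<and> h \<in> rhom B D \<and> h' \<in> rhom B' D
      \<and> compose (carrier A') h f = compose (carrier A') k (rid A')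
      \<and> compose (carrier A') h' f' = k
      \<and> res F B D h (s' (B, f)) = res F B' D h' (s'' (B', f'))"
      using h(2,4) h1(2,4) p1 p2 u(3,4) fam comp_in by blast
  qed
qed

text \<open>The restricted family lives on a pulled back covering: each member \<open>m\<close> is
  assigned some member \<open>(B m, f m)\<close> of \<open>R\<close> mapping to it by
  \<open>q m\<close>, and receives the restriction of the value of \<open>s\<close> there. The
  assignment is arbitrary; \<open>matching_agree\<close> shows that the values are nevertheless
  compatible.\<close>

lemma LA_total:
  assumes C: "A \<in> C" "A' \<in> C" and g: "g \<in> rhom A A'" and x: "x \<in> LS A"
  shows "\<exists>y. (x, y) \<in> LA A A' g"
proof -
  obtain R s where Rs: "x = (R, s)" by force
  have Rs': "R \<in> Cov A" "s \<in> matching_families C F A R" using x Rs LS_D by auto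
  obtain R' where R': "R' \<in> Cov A'" "\<forall>(P, p)\<in>R'. \<exists>(B, f)\<in>R. \<exists>q\<in>rhom B P.
      compose (carrier A) p g = compose (carrier A) q f"
    using pullback_cover[OF C(1) Rs'(1) C(2) g] by blast
  then have "\<forall>m. \<exists>B f q. m \<in> R' \<longrightarrow> (B, f) \<in> R \<and> q \<in> rhom B (fst m)
      \<and> compose (carrier A) (snd m) g = compose (carrier A) q f"
    by fastforce
  then obtain B f q where Bfq: "\<And>m. m \<in> R' \<Longrightarrow> (B m, f m) \<in> R \<and> q m \<in> rhom (B m) (fst m)
      \<and> compose (carrier A) (snd m) g = compose (carrier A) (q m) (f m)"
    by metis
  have fam: "B m \<in> C \<and> f m \<in> rhom A (B m)" if "m \<in> R'" for m
    using family[OF C(1) Rs'(1)] Bfq[OF that] by blast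
  have fam': "fst m \<in> C \<and> snd m \<in> rhom A' (fst m)" if "m \<in> R'" for m
    using family[OF C(2) R'(1), of "fst m" "snd m"] that by simp
  define s' where "s' = (\<lambda>m\<in>R'. res F (B m) (fst m) (q m) (s (B m, f m)))"
  have sB: "s (B m, f m) \<in> sect F (B m)" if "m \<in> R'" for m
    using matching_sect[OF Rs'(2)] Bfq[OF that] by blast
  have "s' \<in> matching_families C F A' R'"
  proof (rule matching_agreeI)
    show "s' \<in> (\<Pi>\<^sub>E m\<in>R'. sect F (fst m))"
      unfolding s'_def using res_closed fam fam' Bfq sB by auto
    fix P1 p1 P2 p2 D h1 h2
    assume m: "(P1, p1) \<in> R'" "(P2, p2) \<in> R'" and D: "D \<in> C"
      and h: "h1 \<in> rhom P1 D" "h2 \<in> rhom P2 D"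
      and e: "compose (carrier A') h1 p1 = compose (carrier A') h2 p2"
    have *: "res F P1 D h1 (s' (P1, p1)) = res F (B m) D (compose (carrier (B m)) h1 (q m)) (s (B m, f m))"
      if "m = (P1, p1)" "(P1, p1) \<in> R'" "h1 \<in> rhom P1 D" for m P1 p1 h1
    proof -
      have mR: "m \<in> R'" using that by simp
      show ?thesis
        using that(1,3) mR res_comp[of "B m" P1 D "q m" h1 "s (B m, f m)"] fam[OF mR] fam'[OF mR] Bfq[OF mR] sB[OF mR] D
        by (simp add: s'_def)
    qed
    let ?m1 = "(P1, p1)" and ?m2 = "(P2, p2)"
    have e2: "h1 (p1 (g a)) = h2 (p2 (g a))" if "a \<in> carrier A" for a
      using e rhom_closed[OF g that] by (simp add: compose_eq_iff)
    have "h1 (q ?m1 (f ?m1 a)) = h2 (q ?m2 (f ?m2 a))" if "a \<in> carrier A" for a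
      using e2[OF that] Bfq[OF m(1)] Bfq[OF m(2)] that by (simp add: compose_eq_iff)
    then have p: "compose (carrier A) (compose (carrier (B ?m1)) h1 (q ?m1)) (f ?m1)
      = compose (carrier A) (compose (carrier (B ?m2)) h2 (q ?m2)) (f ?m2)"
      using fam[OF m(1)] fam[OF m(2)] by (auto simp: compose_eq_iff compose_at)
    show "res F P1 D h1 (s' (P1, p1)) = res F P2 D h2 (s' (P2, p2))"
      unfolding *[OF refl m(1) h(1)] *[OF refl m(2) h(2)]
      by (rule matching_agree[OF C(1) Rs' _ _ D _ _ p])
        (use Bfq[OF m(1)] Bfq[OF m(2)] h fam[OF m(1)] fam[OF m(2)] comp_in in auto)
  qed
  then have y: "(R', s') \<in> LS A'" using R' by (simp add: local_sections_def)
  have "(x, (R', s')) \<in> LA A A' g" unfolding Rs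
  proof (rule LA_I[OF _ y R'(1)])
    show "(R, s) \<in> LS A" using x Rs by simp
    fix D k assume m: "(D, k) \<in> R'"
    let ?m = "(D, k)"
    have "res F (B ?m) D (q ?m) (s (B ?m, f ?m)) = res F D D (rid D) (s' ?m)"
      using res_id[of D "s' ?m"] res_closed[of "B ?m" D] fam[OF m] fam'[OF m] Bfq[OF m] sB[OF m] m
      by (simp add: s'_def)
    moreover have "compose (carrier A') (rid D) k = k" using fam'[OF m] by (simp add: rid_compose)
    ultimately show "\<exists>B f B' f' h h'. (B, f) \<in> R \<and> (B', f') \<in> R'
      \<and> h \<in> rhom B D \<and> h' \<in> rhom B' D
      \<and> compose (carrier A) h f = compose (carrier A) k g
      \<and> compose (carrier A') h' f' = k
      \<and> res F B D h (s (B, f)) = res F B' D h' (s' (B', f'))"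
      using Bfq[OF m] m rid_in[of D] fam'[OF m]
      by (intro exI[of _ "B ?m"] exI[of _ "f ?m"] exI[of _ D] exI[of _ k] exI[of _ "q ?m"]
          exI[of _ "rid D"]) simp
  qed
  then show ?thesis by blast
qed

section \<open>The plus construction\<close>

lemma LA_equiv: "A \<in> C \<Longrightarrow> equiv (LS A) (LA A A (rid A))"
proof (intro equivI)
  assume A: "A \<in> C"
  show "refl_on (LS A) (LA A A (rid A))"
    using LA_refl[OF A] by (auto simp: refl_on_def)
  show "LA A A (rid A) \<subseteq> LS A \<times> LS A" by (rule LA_subset)
  show "sym (LA A A (rid A))" using LA_sym[OF A] by (auto simp: sym_def)
  show "trans (LA A A (rid A))"
    using LA_trans[OF A A A rid_in[OF A] rid_in[OF A]] by (auto simp: compose_rid[OF rid_in[OF A]] intro: transI)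
qed

lemma plus_sectE:
  assumes "X \<in> sect (plus C Cov F) A"
  obtains x where "x \<in> LS A" "X = LA A A (rid A) `` {x}"
  using assms by (auto simp: plus_def elim: quotientE)

text \<open>Restriction of a class is defined as its image under a relation; here it is computed
  from one related pair of representatives. \<open>LA_trans\<close> reduces both inclusions to
  elements related to \<open>x\<close> along \<open>g\<close>, and \<open>LA_functional\<close> puts
  these into the class of \<open>y\<close>.\<close>

lemma plus_res_class:
  assumes C: "A \<in> C" "A' \<in> C" and g: "g \<in> rhom A A'" and xy: "(x, y) \<in> LA A A' g"
  shows "res (plus C Cov F) A A' g (LA A A (rid A) `` {x}) = LA A' A' (rid A') `` {y}"
proof -
  have x: "x \<in> LS A" using xy LA_subset by blast
  have "(x, z) \<in> LA A A' g" if "(x, x') \<in> LA A A (rid A)" "(x', z) \<in> LA A A' g" for x' z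
    using LA_trans[OF C(1,1,2) rid_in[OF C(1)] g that] compose_rid[OF g] by simp
  moreover have "(x, z) \<in> LA A A' g" if "(y, z) \<in> LA A' A' (rid A')" for z
    using LA_trans[OF C(1,2,2) g rid_in[OF C(2)] xy that] rid_compose[OF g] by simp
  ultimately have "LA A A' g `` (LA A A (rid A) `` {x}) = LA A' A' (rid A') `` {y}"
    using LA_functional[OF C g xy] LA_refl[OF C(1) x] by blast
  then show ?thesis by (simp add: plus_def)
qed

text \<open>Makes all results of this context available for the second plus construction as
  well.\<close>

lemma plus_presheaf: "presheaf_on C Cov (plus C Cov F)"
proof (intro presheaf_on.intro ring_site_axioms presheaf_on_axioms.intro)
  fix A B f X
  assume C: "A \<in> C" "B \<in> C" and f: "f \<in> rhom A B" and X: "X \<in> sect (plus C Cov F) A"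
  obtain x where x: "x \<in> LS A" "X = LA A A (rid A) `` {x}" using plus_sectE[OF X] .
  obtain y where y: "(x, y) \<in> LA A B f" using LA_total[OF C f x(1)] by blast
  then have "y \<in> LS B" using LA_subset by blast
  then show "res (plus C Cov F) A B f X \<in> sect (plus C Cov F) B"
    unfolding x(2) plus_res_class[OF C f y] by (simp add: plus_def quotientI)
next
  fix A X
  assume A: "A \<in> C" and X: "X \<in> sect (plus C Cov F) A"
  obtain x where x: "x \<in> LS A" "X = LA A A (rid A) `` {x}" using plus_sectE[OF X] .
  show "res (plus C Cov F) A A (rid A) X = X"
    using plus_res_class[OF A A rid_in[OF A] LA_refl[OF A x(1)]] x(2) by simp
next
  fix A B D f g X
  assume C: "A \<in> C" "B \<in> C" "D \<in> C" and f: "f \<in> rhom A B" and g: "g \<in> rhom B D"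
    and X: "X \<in> sect (plus C Cov F) A"
  obtain x where x: "x \<in> LS A" "X = LA A A (rid A) `` {x}" using plus_sectE[OF X] .
  obtain y where y: "(x, y) \<in> LA A B f" using LA_total[OF C(1,2) f x(1)] by blast
  then have "y \<in> LS B" using LA_subset by blast
  then obtain z where z: "(y, z) \<in> LA B D g" using LA_total[OF C(2,3) g] by blast
  show "res (plus C Cov F) B D g (res (plus C Cov F) A B f X)
    = res (plus C Cov F) A D (compose (carrier A) g f) X"
    unfolding x(2) plus_res_class[OF C(1,2) f y] plus_res_class[OF C(2,3) g z]
      plus_res_class[OF C(1,3) comp_in[OF C(1) f g] LA_trans[OF C f g y z]] ..
qed

text \<open>The right-hand side is the image of a section of \<open>F\<close> under the canonical map from \<open>F\<close>
  to the plus presheaf.\<close>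

lemma plus_res_member:
  assumes A: "A \<in> C" and X: "X \<in> sect (plus C Cov F) A" and Rs: "(R, s) \<in> X"
    and m: "(B, f) \<in> R" and E: "E \<in> C" and h: "h \<in> rhom B E"
  shows "res (plus C Cov F) A E (compose (carrier A) h f) X
    = LA E E (rid E) `` {({(E, rid E)}, \<lambda>m\<in>{(E, rid E)}. res F B E h (s (B, f)))}"
proof -
  obtain x where x: "x \<in> LS A" "X = LA A A (rid A) `` {x}" using plus_sectE[OF X] .
  have X': "X = LA A A (rid A) `` {(R, s)}"
    using Rs x equiv_class_eq_iff[OF LA_equiv[OF A]] by simp
  have LS: "(R, s) \<in> LS A" using Rs x LA_subset by blast
  note B = family[OF A LS_D(1)[OF LS] m]
  have y: "res F B E h (s (B, f)) \<in> sect F E"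
    using res_closed B E h matching_sect[OF LS_D(2)[OF LS] m] by blast
  have hf: "compose (carrier A) h f \<in> rhom A E" using A B h comp_in by blast
  let ?t = "\<lambda>m\<in>{(E, rid E)}. res F B E h (s (B, f))"
  have "?t \<in> matching_families C F E {(E, rid E)}"
  proof (rule matching_agreeI)
    fix B1 f1 B2 f2 D h1 h2
    assume "(B1, f1) \<in> {(E, rid E)}" "(B2, f2) \<in> {(E, rid E)}" "h1 \<in> rhom B1 D" "h2 \<in> rhom B2 D"
      "compose (carrier E) h1 f1 = compose (carrier E) h2 f2"
    then show "res F B1 D h1 (?t (B1, f1)) = res F B2 D h2 (?t (B2, f2))"
      by (auto simp: compose_rid)
  qed (use y in auto)
  then have LS': "({(E, rid E)}, ?t) \<in> LS E"
    using identity_cover[OF E] by (simp add: local_sections_def)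
  \<comment> \<open>The identity covering of \<open>E\<close> witnesses the relation itself: its
    only member is reached from \<open>(B, f)\<close> by \<open>h\<close>.\<close>
  have "((R, s), ({(E, rid E)}, ?t)) \<in> LA A E (compose (carrier A) h f)"
  proof (rule LA_I[OF LS LS' identity_cover[OF E]])
    fix D k assume Dk: "(D, k) \<in> {(E, rid E)}"
    then have "D = E" "k = rid E" by auto
    moreover have "compose (carrier A) h f = compose (carrier A) (rid E) (compose (carrier A) h f)"
      using rid_compose[OF hf] by simp
    moreover have "compose (carrier E) (rid E) (rid E) = rid E" by (rule compose_rid[OF rid_in[OF E]])
    moreover have "res F B E h (s (B, f)) = res F E E (rid E) (?t (E, rid E))"
      using res_id[OF E y] by simp
    ultimately show "\<exists>B f' B' f'' h' h''. (B, f') \<in> R \<and> (B', f'') \<in> {(E, rid E)}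
      \<and> h' \<in> rhom B D \<and> h'' \<in> rhom B' D
      \<and> compose (carrier A) h' f' = compose (carrier A) k (compose (carrier A) h f)
      \<and> compose (carrier E) h'' f'' = k
      \<and> res F B D h' (s (B, f')) = res F B' D h'' (?t (B', f''))"
      using m h rid_in[OF E] by blast
  qed
  then show ?thesis unfolding X' by (rule plus_res_class[OF A E hf])
qed

end

section \<open>Morphisms of presheaves\<close>

definition natural_on ::
  "'u ring set \<Rightarrow> ('u, 'x) presheaf \<Rightarrow> ('u, 'y) presheaf \<Rightarrow> ('u ring \<Rightarrow> 'x \<Rightarrow> 'y) \<Rightarrow> bool"
  where "natural_on C F G t \<longleftrightarrow>
    (\<forall>A\<in>C. \<forall>x\<in>sect F A. t A x \<in> sect G A) \<and>
    (\<forall>A\<in>C. \<forall>B\<in>C. \<forall>f\<in>rhom A B. \<forall>x\<in>sect F A. t B (res F A B f x) = res G A B f (t A x))"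

text \<open>This is the map on representatives inside \<open>plus_map\<close>, named so that its
  compatibility with local agreement can be stated.\<close>

definition push_family ::
  "('u ring \<Rightarrow> 'x \<Rightarrow> 'y) \<Rightarrow> 'u arrow set \<times> ('u arrow \<Rightarrow> 'x) \<Rightarrow> 'u arrow set \<times> ('u arrow \<Rightarrow> 'y)"
  where "push_family t = (\<lambda>(R, s). (R, \<lambda>m\<in>R. t (fst m) (s m)))"

locale presheaf_morphism = F: presheaf_on C Cov F + G: presheaf_on C Cov G
  for C :: "'u ring set" and Cov :: "'u coverings"
    and F :: "('u, 'x) presheaf" and G :: "('u, 'y) presheaf" +
  fixes t :: "'u ring \<Rightarrow> 'x \<Rightarrow> 'y"
  assumes natural: "natural_on C F G t"
begin

lemma closed: "A \<in> C \<Longrightarrow> x \<in> sect F A \<Longrightarrow> t A x \<in> sect G A"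
  using natural by (simp add: natural_on_def)

lemma commute:
  "A \<in> C \<Longrightarrow> B \<in> C \<Longrightarrow> f \<in> rhom A B \<Longrightarrow> x \<in> sect F A \<Longrightarrow> t B (res F A B f x) = res G A B f (t A x)"
  using natural by (simp add: natural_on_def)

lemma push_local_section:
  assumes A: "A \<in> C" and x: "x \<in> F.LS A"
  shows "push_family t x \<in> G.LS A"
proof -
  obtain R s where Rs: "x = (R, s)" by force
  note R = F.LS_D[OF x[unfolded Rs]]
  note fam = F.family[OF A R(1)]
  have "(\<lambda>m\<in>R. t (fst m) (s m)) \<in> matching_families C G A R"
  proof (rule G.matching_agreeI)
    show "(\<lambda>m\<in>R. t (fst m) (s m)) \<in> (\<Pi>\<^sub>E m\<in>R. sect G (fst m))"
      using closed fam F.matching_sect[OF R(2)] by fastforce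
  next
    fix B f B' f' D h h'
    assume m: "(B, f) \<in> R" "(B', f') \<in> R" and D: "D \<in> C" and h: "h \<in> rhom B D" "h' \<in> rhom B' D"
      and e: "compose (carrier A) h f = compose (carrier A) h' f'"
    have "t D (res F B D h (s (B, f))) = t D (res F B' D h' (s (B', f')))"
      using F.matching_agree[OF A R m D h e] by simp
    then show "res G B D h ((\<lambda>m\<in>R. t (fst m) (s m)) (B, f))
      = res G B' D h' ((\<lambda>m\<in>R. t (fst m) (s m)) (B', f'))"
      using commute[of B D h "s (B, f)"] commute[of B' D h' "s (B', f')"] m fam D h
        F.matching_sect[OF R(2)] by simp
  qed
  then show ?thesis using R by (simp add: Rs push_family_def local_sections_def)
qed

lemma push_agree:
  assumes C: "A \<in> C" "A' \<in> C" and xy: "(x, y) \<in> F.LA A A' g"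
  shows "(push_family t x, push_family t y) \<in> G.LA A A' g"
proof -
  obtain R s where x: "x = (R, s)" by force
  obtain R' s' where y: "y = (R', s')" by force
  obtain T where T: "(R, s) \<in> F.LS A" "(R', s') \<in> F.LS A'" "T \<in> Cov A'"
    "\<And>D k. (D, k) \<in> T \<Longrightarrow> \<exists>B f B' f' h h'. (B, f) \<in> R \<and> (B', f') \<in> R'
      \<and> h \<in> rhom B D \<and> h' \<in> rhom B' D
      \<and> compose (carrier A) h f = compose (carrier A) k g
      \<and> compose (carrier A') h' f' = k
      \<and> res F B D h (s (B, f)) = res F B' D h' (s' (B', f'))"
    using F.LA_E[OF xy[unfolded x y]] by blast
  note ms = F.LS_D[OF T(1)] F.LS_D[OF T(2)]
  let ?s = "\<lambda>m\<in>R. t (fst m) (s m)" and ?s' = "\<lambda>m\<in>R'. t (fst m) (s' m)"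
  have "((R, ?s), (R', ?s')) \<in> G.LA A A' g"
  proof (rule G.LA_I[OF _ _ T(3)])
    show "(R, ?s) \<in> G.LS A" "(R', ?s') \<in> G.LS A'"
      using push_local_section[OF C(1) T(1)] push_local_section[OF C(2) T(2)]
      by (simp_all add: push_family_def)
  next
    fix D k assume Dk: "(D, k) \<in> T"
    have D: "D \<in> C" using F.family[OF C(2) T(3) Dk] by simp
    obtain B f B' f' h h' where h: "(B, f) \<in> R" "(B', f') \<in> R'" "h \<in> rhom B D" "h' \<in> rhom B' D"
      "compose (carrier A) h f = compose (carrier A) k g" "compose (carrier A') h' f' = k"
      "res F B D h (s (B, f)) = res F B' D h' (s' (B', f'))"
      using T(4)[OF Dk] by blast
    have "res G B D h (?s (B, f)) = t D (res F B D h (s (B, f)))"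
      using commute[of B D h "s (B, f)"] h(1,3) D F.family[OF C(1) ms(1) h(1)]
        F.matching_sect[OF ms(2) h(1)] by simp
    also have "\<dots> = t D (res F B' D h' (s' (B', f')))" using h(7) by simp
    also have "\<dots> = res G B' D h' (?s' (B', f'))"
      using commute[of B' D h' "s' (B', f')"] h(2,4) D F.family[OF C(2) ms(3) h(2)]
        F.matching_sect[OF ms(4) h(2)] by simp
    finally show "\<exists>B f B' f' h h'. (B, f) \<in> R \<and> (B', f') \<in> R'
      \<and> h \<in> rhom B D \<and> h' \<in> rhom B' D
      \<and> compose (carrier A) h f = compose (carrier A) k g
      \<and> compose (carrier A') h' f' = k
      \<and> res G B D h (?s (B, f)) = res G B' D h' (?s' (B', f'))"
      using h(1-6) by blast
  qed
  then show ?thesis by (simp add: x y push_family_def)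
qed

text \<open>\<open>plus_map\<close> takes the union over all representatives of a class. Pushing
  forward preserves local agreement, so one representative determines the result.\<close>

lemma plus_map_class:
  assumes A: "A \<in> C" and x: "x \<in> F.LS A"
  shows "plus_map C Cov G t A (F.LA A A (rid A) `` {x}) = G.LA A A (rid A) `` {push_family t x}"
proof -
  have "plus_map C Cov G t A X = G.LA A A (rid A) `` (push_family t ` X)" for X
    by (simp add: plus_map_def push_family_def)
  moreover have "(push_family t x, z) \<in> G.LA A A (rid A)"
    if "(x, x') \<in> F.LA A A (rid A)" "(push_family t x', z) \<in> G.LA A A (rid A)" for x' z
    using push_agree[OF A A that(1)] that(2) G.LA_equiv[OF A] by (meson equivE transE)
  ultimately show ?thesis using F.LA_refl[OF A x] by blast
qed

lemma plus_morphism: "presheaf_morphism C Cov (plus C Cov F) (plus C Cov G) (plus_map C Cov G t)"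
proof (intro presheaf_morphism.intro F.plus_presheaf G.plus_presheaf presheaf_morphism_axioms.intro)
  have "plus_map C Cov G t A X \<in> sect (plus C Cov G) A"
    if A: "A \<in> C" and X: "X \<in> sect (plus C Cov F) A" for A X
  proof -
    obtain x where x: "x \<in> F.LS A" "X = F.LA A A (rid A) `` {x}" using F.plus_sectE[OF X] .
    show ?thesis unfolding x(2) plus_map_class[OF A x(1)]
      using push_local_section[OF A x(1)] by (simp add: plus_def quotientI)
  qed
  moreover have "plus_map C Cov G t B (res (plus C Cov F) A B f X)
      = res (plus C Cov G) A B f (plus_map C Cov G t A X)"
    if C: "A \<in> C" "B \<in> C" and f: "f \<in> rhom A B" and X: "X \<in> sect (plus C Cov F) A" for A B f X
  proof -
    obtain x where x: "x \<in> F.LS A" "X = F.LA A A (rid A) `` {x}" using F.plus_sectE[OF X] .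
    obtain y where y: "(x, y) \<in> F.LA A B f" using F.LA_total[OF C f x(1)] by blast
    then have "y \<in> F.LS B" using F.LA_subset by blast
    then show ?thesis
      unfolding x(2) F.plus_res_class[OF C f y] plus_map_class[OF C(1) x(1)]
        G.plus_res_class[OF C f push_agree[OF C y]] by (rule plus_map_class[OF C(2)])
  qed
  ultimately show "natural_on C (plus C Cov F) (plus C Cov G) (plus_map C Cov G t)"
    by (simp add: natural_on_def)
qed

text \<open>Over a member \<open>E\<close> of \<open>V\<close> the representatives only acquire
  equal images under \<open>t E\<close>. Naturality carries this equality to any \<open>D\<close>
  over \<open>E\<close>, and injectivity of \<open>t D\<close> turns it into an equality of sections
  of \<open>F\<close>. The ring \<open>D\<close> is left arbitrary because \<open>A\<close> will be
  a member of an outer covering, over which no suitable \<open>D\<close> can be chosen yet.\<close>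

lemma plus_map_eq_locally:
  assumes A: "A \<in> C" and X: "X \<in> sect (plus C Cov F) A" and Y: "Y \<in> sect (plus C Cov F) A"
    and eq: "plus_map C Cov G t A X = plus_map C Cov G t A Y"
  shows "\<exists>V\<in>Cov A. \<forall>(E, l)\<in>V. \<forall>D\<in>C. \<forall>e\<in>rhom E D. inj_on (t D) (sect F D) \<longrightarrow>
    res (plus C Cov F) A D (compose (carrier A) e l) X
      = res (plus C Cov F) A D (compose (carrier A) e l) Y"
proof -
  obtain x where x: "x \<in> F.LS A" "X = F.LA A A (rid A) `` {x}" using F.plus_sectE[OF X] .
  obtain y where y: "y \<in> F.LS A" "Y = F.LA A A (rid A) `` {y}" using F.plus_sectE[OF Y] .
  have in_class: "x \<in> X" "y \<in> Y" using F.LA_refl[OF A] x y by auto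
  have "(push_family t x, push_family t y) \<in> G.LA A A (rid A)"
    using eq eq_equiv_class[OF _ G.LA_equiv[OF A] push_local_section[OF A y(1)]]
    unfolding x(2) y(2) plus_map_class[OF A x(1)] plus_map_class[OF A y(1)] by blast
  moreover obtain R s where Rs: "x = (R, s)" by force
  moreover obtain R' s' where Rs': "y = (R', s')" by force
  ultimately have
    "((R, \<lambda>m\<in>R. t (fst m) (s m)), (R', \<lambda>m\<in>R'. t (fst m) (s' m))) \<in> G.LA A A (rid A)"
    by (simp add: push_family_def)
  then obtain V where V: "V \<in> Cov A"
    "\<And>D k. (D, k) \<in> V \<Longrightarrow> \<exists>B f B' f' h h'. (B, f) \<in> R \<and> (B', f') \<in> R'
      \<and> h \<in> rhom B D \<and> h' \<in> rhom B' D
      \<and> compose (carrier A) h f = compose (carrier A) k (rid A)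
      \<and> compose (carrier A) h' f' = k
      \<and> res G B D h ((\<lambda>m\<in>R. t (fst m) (s m)) (B, f))
        = res G B' D h' ((\<lambda>m\<in>R'. t (fst m) (s' m)) (B', f'))"
    by (rule G.LA_E) blast
  note ms = F.LS_D[OF x(1)[unfolded Rs]] F.LS_D[OF y(1)[unfolded Rs']]
  have *: "res (plus C Cov F) A D (compose (carrier A) e l) X
      = res (plus C Cov F) A D (compose (carrier A) e l) Y"
    if El: "(E, l) \<in> V" and D: "D \<in> C" and e: "e \<in> rhom E D" and inj: "inj_on (t D) (sect F D)"
    for E l D e
  proof -
    have E: "E \<in> C" "l \<in> rhom A E" using F.family[OF A V(1) El] by auto
    obtain B f B' f' h h' where h: "(B, f) \<in> R" "(B', f') \<in> R'" "h \<in> rhom B E" "h' \<in> rhom B' E"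
      "compose (carrier A) h f = l" "compose (carrier A) h' f' = l"
      "res G B E h ((\<lambda>m\<in>R. t (fst m) (s m)) (B, f))
        = res G B' E h' ((\<lambda>m\<in>R'. t (fst m) (s' m)) (B', f'))"
      using V(2)[OF El] unfolding compose_rid[OF E(2)] by blast
    note B = F.family[OF A ms(1) h(1)] and B' = F.family[OF A ms(3) h(2)]
    note sB = F.matching_sect[OF ms(2) h(1)] and sB' = F.matching_sect[OF ms(4) h(2)]
    define p where "p = compose (carrier B) e h"
    define q where "q = compose (carrier B') e h'"
    have p: "p \<in> rhom B D" using F.comp_in[of B h E e D] B h(3) e by (simp add: p_def)
    have q: "q \<in> rhom B' D" using F.comp_in[of B' h' E e D] B' h(4) e by (simp add: q_def)
    have "t E (res F B E h (s (B, f))) = t E (res F B' E h' (s' (B', f')))"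
      using h(7) commute[of B E h "s (B, f)"] commute[of B' E h' "s' (B', f')"] B B' E sB sB' h(1-4)
      by simp
    then have "t D (res F E D e (res F B E h (s (B, f))))
        = t D (res F E D e (res F B' E h' (s' (B', f'))))"
      using commute[OF E(1) D e] F.res_closed[of B E h "s (B, f)"]
        F.res_closed[of B' E h' "s' (B', f')"] B B' E sB sB' h(3,4) by simp
    then have "t D (res F B D p (s (B, f))) = t D (res F B' D q (s' (B', f')))"
      using F.res_comp[of B E D h e "s (B, f)"] F.res_comp[of B' E D h' e "s' (B', f')"]
        B B' E D e sB sB' h(3,4) by (simp add: p_def q_def)
    then have eq: "res F B D p (s (B, f)) = res F B' D q (s' (B', f'))"
      using inj_onD[OF inj] F.res_closed B B' D p q sB sB' by blast
    have "compose (carrier A) e l = compose (carrier A) p f"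
      unfolding p_def h(5)[symmetric] using B by (auto simp: compose_eq_iff compose_at compose_eq)
    moreover have "compose (carrier A) e l = compose (carrier A) q f'"
      unfolding q_def h(6)[symmetric] using B' by (auto simp: compose_eq_iff compose_at compose_eq)
    ultimately show ?thesis
      using F.plus_res_member[OF A X in_class(1)[unfolded Rs] h(1) D p]
        F.plus_res_member[OF A Y in_class(2)[unfolded Rs'] h(2) D q] eq by simp
  qed
  show ?thesis by (rule bexI[OF _ V(1)], clarify, rule *)
qed

end

section \<open>Injectivity on sheafifications from injectivity on refinements\<close>

theorem sheafify_map_inj_on:
  fixes C :: "'u ring set" and Cov :: "'u coverings"
  assumes "presheaf_morphism C Cov F G t" and A: "A \<in> C"
    and dom: "\<And>R. R \<in> Cov A \<Longrightarrow>
      \<exists>S\<in>Cov A. refines_covering A S R \<and> (\<forall>(B, g)\<in>S. inj_on (t B) (sect F B))"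
  shows "inj_on (sheafify_map C Cov G t A) (sect (sheafify C Cov F) A)"
proof (rule inj_onI)
  interpret presheaf_morphism C Cov F G t by fact
  interpret P: presheaf_morphism C Cov "plus C Cov F" "plus C Cov G" "plus_map C Cov G t"
    by (rule plus_morphism)
  fix X Y
  assume X: "X \<in> sect (sheafify C Cov F) A" and Y: "Y \<in> sect (sheafify C Cov F) A"
    and eq: "sheafify_map C Cov G t A X = sheafify_map C Cov G t A Y"
  obtain x where x: "x \<in> P.F.LS A" "X = P.F.LA A A (rid A) `` {x}"
    using P.F.plus_sectE[OF X[unfolded sheafify_def]] .
  obtain y where y: "y \<in> P.F.LS A" "Y = P.F.LA A A (rid A) `` {y}"
    using P.F.plus_sectE[OF Y[unfolded sheafify_def]] .
  have "(push_family (plus_map C Cov G t) x, push_family (plus_map C Cov G t) y)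
      \<in> P.G.LA A A (rid A)"
    using eq eq_equiv_class[OF _ P.G.LA_equiv[OF A] P.push_local_section[OF A y(1)]]
    unfolding sheafify_map_def x(2) y(2) P.plus_map_class[OF A x(1)] P.plus_map_class[OF A y(1)]
    by blast
  moreover obtain R s where Rs: "x = (R, s)" by force
  moreover obtain R' s' where Rs': "y = (R', s')" by force
  ultimately have "((R, \<lambda>m\<in>R. plus_map C Cov G t (fst m) (s m)),
      (R', \<lambda>m\<in>R'. plus_map C Cov G t (fst m) (s' m))) \<in> P.G.LA A A (rid A)"
    by (simp add: push_family_def)
  then obtain T where T: "T \<in> Cov A"
    "\<And>D k. (D, k) \<in> T \<Longrightarrow> \<exists>B f B' f' h h'. (B, f) \<in> R \<and> (B', f') \<in> R'
      \<and> h \<in> rhom B D \<and> h' \<in> rhom B' D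
      \<and> compose (carrier A) h f = compose (carrier A) k (rid A)
      \<and> compose (carrier A) h' f' = k
      \<and> res (plus C Cov G) B D h ((\<lambda>m\<in>R. plus_map C Cov G t (fst m) (s m)) (B, f))
        = res (plus C Cov G) B' D h' ((\<lambda>m\<in>R'. plus_map C Cov G t (fst m) (s' m)) (B', f'))"
    by (rule P.G.LA_E) blast
  note ms = P.F.LS_D[OF x(1)[unfolded Rs]] P.F.LS_D[OF y(1)[unfolded Rs']]
  let ?res = "res (plus C Cov F)"
  \<comment> \<open>This is the condition that local agreement of \<open>x\<close> and
    \<open>y\<close> imposes on a ring \<open>E\<close> reached from \<open>A\<close> by
    \<open>k\<close> followed by \<open>g\<close>.\<close>
  define agree where "agree = (\<lambda>(k :: 'u \<Rightarrow> 'u) E g. \<exists>B f B' f' h h'. (B, f) \<in> R \<and> (B', f') \<in> R'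
      \<and> h \<in> rhom B E \<and> h' \<in> rhom B' E
      \<and> compose (carrier A) h f = compose (carrier A) g k
      \<and> compose (carrier A) h' f' = compose (carrier A) g k
      \<and> ?res B E h (s (B, f)) = ?res B' E h' (s' (B', f')))"
  have "\<exists>V. V \<in> Cov (fst m) \<and> (\<forall>(E, l)\<in>V. \<forall>E'\<in>C. \<forall>e\<in>rhom E E'. inj_on (t E') (sect F E') \<longrightarrow>
      agree (snd m) E' (compose (carrier (fst m)) e l))" if mT: "m \<in> T" for m
  proof -
    obtain D k where m: "m = (D, k)" by force
    then have Dk: "(D, k) \<in> T" using mT by simp
    have D: "D \<in> C" "k \<in> rhom A D" using F.family[OF A T(1) Dk] by auto
    obtain B f B' f' h h' where h: "(B, f) \<in> R" "(B', f') \<in> R'" "h \<in> rhom B D" "h' \<in> rhom B' D"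
      "compose (carrier A) h f = k" "compose (carrier A) h' f' = k"
      "res (plus C Cov G) B D h ((\<lambda>m\<in>R. plus_map C Cov G t (fst m) (s m)) (B, f))
        = res (plus C Cov G) B' D h' ((\<lambda>m\<in>R'. plus_map C Cov G t (fst m) (s' m)) (B', f'))"
      using T(2)[OF Dk] unfolding compose_rid[OF D(2)] by blast
    note B = F.family[OF A ms(1) h(1)] and B' = F.family[OF A ms(3) h(2)]
    note sB = P.F.matching_sect[OF ms(2) h(1)] and sB' = P.F.matching_sect[OF ms(4) h(2)]
    have "plus_map C Cov G t D (?res B D h (s (B, f)))
        = plus_map C Cov G t D (?res B' D h' (s' (B', f')))"
      using h(7) P.commute[of B D h "s (B, f)"] P.commute[of B' D h' "s' (B', f')"]
        B B' D sB sB' h(1-4) by simp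
    \<comment> \<open>The values of the outer families are themselves classes, here restricted to
      \<open>D\<close> and with equal images under the inner map, so the inner layer is unwound over
      \<open>D\<close>.\<close>
    then obtain V where V: "V \<in> Cov D"
      "\<forall>(E, l)\<in>V. \<forall>E'\<in>C. \<forall>e\<in>rhom E E'. inj_on (t E') (sect F E') \<longrightarrow>
        ?res D E' (compose (carrier D) e l) (?res B D h (s (B, f)))
          = ?res D E' (compose (carrier D) e l) (?res B' D h' (s' (B', f')))"
      using plus_map_eq_locally[OF D(1) P.F.res_closed[OF _ D(1) h(3) sB]
          P.F.res_closed[OF _ D(1) h(4) sB']] B B' by blast
    have *: "agree k E' (compose (carrier D) e l)"
      if El: "(E, l) \<in> V" and E': "E' \<in> C" and e: "e \<in> rhom E E'" and inj: "inj_on (t E') (sect F E')"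
      for E l E' e
    proof -
      define g where "g = compose (carrier D) e l"
      have E: "E \<in> C" "l \<in> rhom D E" using F.family[OF D(1) V(1) El] by auto
      have g: "g \<in> rhom D E'" unfolding g_def by (rule F.comp_in[OF D(1) E(2) e])
      have "?res D E' g (?res B D h (s (B, f))) = ?res D E' g (?res B' D h' (s' (B', f')))"
        using V(2) El E' e inj unfolding g_def by blast
      then have "?res B E' (compose (carrier B) g h) (s (B, f))
          = ?res B' E' (compose (carrier B') g h') (s' (B', f'))"
        using P.F.res_comp[OF _ D(1) E' h(3) g sB] P.F.res_comp[OF _ D(1) E' h(4) g sB'] B B' by simp
      moreover have "compose (carrier A) (compose (carrier B) g h) f = compose (carrier A) g k"
        unfolding h(5)[symmetric] using B by (auto simp: compose_eq_iff compose_at compose_eq)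
      moreover have "compose (carrier A) (compose (carrier B') g h') f' = compose (carrier A) g k"
        unfolding h(6)[symmetric] using B' by (auto simp: compose_eq_iff compose_at compose_eq)
      moreover have "compose (carrier B) g h \<in> rhom B E'" "compose (carrier B') g h' \<in> rhom B' E'"
        using F.comp_in[OF _ h(3) g] F.comp_in[OF _ h(4) g] B B' by auto
      ultimately show ?thesis unfolding agree_def g_def[symmetric] using h(1,2) by blast
    qed
    have "\<forall>(E, l)\<in>V. \<forall>E'\<in>C. \<forall>e\<in>rhom E E'. inj_on (t E') (sect F E') \<longrightarrow>
        agree k E' (compose (carrier D) e l)"
      by (clarify, rule *)
    then show ?thesis using V(1) unfolding m fst_conv snd_conv by blast
  qed
  then have "\<forall>m\<in>T. \<exists>V. V \<in> Cov (fst m) \<and> (\<forall>(E, l)\<in>V. \<forall>E'\<in>C. \<forall>e\<in>rhom E E'.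
      inj_on (t E') (sect F E') \<longrightarrow> agree (snd m) E' (compose (carrier (fst m)) e l))"
    by blast
  then obtain V where V: "\<forall>m\<in>T. V m \<in> Cov (fst m) \<and> (\<forall>(E, l)\<in>V m. \<forall>E'\<in>C. \<forall>e\<in>rhom E E'.
      inj_on (t E') (sect F E') \<longrightarrow> agree (snd m) E' (compose (carrier (fst m)) e l))"
    by (rule bchoice[THEN exE])
  \<comment> \<open>Composing the coverings \<open>V m\<close> with \<open>T\<close> leads back to a
    covering of \<open>A\<close>, to which \<open>dom\<close> applies. A member of the refinement
    \<open>S\<close> then maps from some \<open>E\<close>, and it is the base change over which
    \<open>V\<close> promises agreement.\<close>
  let ?U = "{(E, compose (carrier A) l k) | D k E l. (D, k) \<in> T \<and> (E, l) \<in> V (D, k)}"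
  have "?U \<in> Cov A"
    by (rule F.composition[OF A T(1)]) (use V in force)
  then obtain S where S: "S \<in> Cov A" "refines_covering A S ?U"
    "\<forall>(B, g)\<in>S. inj_on (t B) (sect F B)"
    using dom by blast
  have "(x, y) \<in> P.F.LA A A (rid A)" unfolding Rs Rs'
  proof (rule P.F.LA_I[OF _ _ S(1)])
    show "(R, s) \<in> P.F.LS A" "(R', s') \<in> P.F.LS A" using x y Rs Rs' by auto
    fix E' g assume m: "(E', g) \<in> S"
    have E': "E' \<in> C" "g \<in> rhom A E'" using F.family[OF A S(1) m] by auto
    obtain E j e where "(E, j) \<in> ?U" and e: "e \<in> rhom E E'" "compose (carrier A) e j = g"
      using S(2) m unfolding refines_covering_def by fast
    then obtain D k l where j: "j = compose (carrier A) l k" "(D, k) \<in> T" "(E, l) \<in> V (D, k)"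
      by blast
    have k: "k \<in> rhom A D" using F.family[OF A T(1) j(2)] by auto
    have "inj_on (t E') (sect F E')" using S(3) m by blast
    then have "agree k E' (compose (carrier D) e l)"
      using V j(2,3) E'(1) e(1) by fastforce
    moreover have "compose (carrier A) (compose (carrier D) e l) k = g"
      unfolding e(2)[symmetric] j(1) using k by (auto simp: compose_eq_iff compose_at compose_eq)
    ultimately show "\<exists>B f B' f' h h'. (B, f) \<in> R \<and> (B', f') \<in> R'
      \<and> h \<in> rhom B E' \<and> h' \<in> rhom B' E'
      \<and> compose (carrier A) h f = compose (carrier A) g (rid A)
      \<and> compose (carrier A) h' f' = g
      \<and> ?res B E' h (s (B, f)) = ?res B' E' h' (s' (B', f'))"
      unfolding agree_def compose_rid[OF E'(2)] by simp
  qed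
  then show "X = Y" unfolding x(2) y(2) by (rule equiv_class_eq[OF P.F.LA_equiv[OF A]])
qed

section \<open>The additive group of the Witt ring\<close>

locale witt_ring = cring R for R :: "'a ring" (structure)
begin

abbreviation W where "W \<equiv> witt_group R"

definition trunc :: "nat \<Rightarrow> (nat \<Rightarrow> 'a) \<Rightarrow> nat \<Rightarrow> 'a"
  where "trunc n v = (\<lambda>i. if i \<le> n then v i else \<zero>)"

lemma witt_mult: "(v \<otimes>\<^bsub>W\<^esub> w) n = (\<Oplus>i\<in>{..n}. v i \<otimes> w (n - i))"
  by (simp add: witt_group_def)

lemma witt_one: "\<one>\<^bsub>W\<^esub> = (\<lambda>n. if n = 0 then \<one> else \<zero>)"
  by (simp add: witt_group_def)

lemma witt_carrier: "w \<in> carrier W \<longleftrightarrow> (\<forall>n. w n \<in> carrier R) \<and> w 0 = \<one>"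
  by (auto simp: witt_group_def)

lemma witt_coeff [simp]: "w \<in> carrier W \<Longrightarrow> w n \<in> carrier R"
  by (simp add: witt_carrier)

lemma trunc_up: "w \<in> carrier W \<Longrightarrow> trunc n w \<in> up R"
  by (rule mem_upI) (auto simp: trunc_def intro!: exI[of _ n])

lemma trunc_eq: "i \<le> n \<Longrightarrow> trunc n w i = w i"
  by (simp add: trunc_def)

lemma UP_mult:
  "p \<in> up R \<Longrightarrow> q \<in> up R \<Longrightarrow> p \<otimes>\<^bsub>UP R\<^esub> q = (\<lambda>n. \<Oplus>i\<in>{..n}. p i \<otimes> q (n - i))"
  by (simp add: UP_def)

lemma UP_carrier: "carrier (UP R) = up R"
  by (simp add: UP_def)

lemma up_coeff: "p \<in> up R \<Longrightarrow> p n \<in> carrier R"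
  by (rule mem_upD)

text \<open>Stated for all \<open>k \<le> n\<close> and not just \<open>k = n\<close>: for
  associativity the lower coefficients of an inner product are needed with one and the same
  truncation.\<close>

lemma witt_mult_trunc:
  assumes "v \<in> carrier W" "w \<in> carrier W" "k \<le> n"
  shows "(v \<otimes>\<^bsub>W\<^esub> w) k = (trunc n v \<otimes>\<^bsub>UP R\<^esub> trunc n w) k"
  unfolding witt_mult UP_mult[OF trunc_up[OF assms(1)] trunc_up[OF assms(2)]]
  using assms up_coeff[OF trunc_up[OF assms(1)]] up_coeff[OF trunc_up[OF assms(2)]]
  by (intro finsum_cong') (auto simp: trunc_eq)

lemma witt_mult_closed:
  assumes "v \<in> carrier W" "w \<in> carrier W"
  shows "v \<otimes>\<^bsub>W\<^esub> w \<in> carrier W"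
  unfolding witt_carrier
proof
  show "\<forall>n. (v \<otimes>\<^bsub>W\<^esub> w) n \<in> carrier R"
    using assms by (auto simp: witt_mult intro!: finsum_closed)
  show "(v \<otimes>\<^bsub>W\<^esub> w) 0 = \<one>"
    using assms by (simp add: witt_mult witt_carrier)
qed

lemma witt_one_closed: "\<one>\<^bsub>W\<^esub> \<in> carrier W"
  by (simp add: witt_carrier witt_one)

text \<open>The coefficient of degree \<open>n\<close> of a product only involves coefficients of degree at most
  \<open>n\<close>, so the monoid laws are inherited from polynomials by truncation.\<close>

lemma witt_comm_monoid: "comm_monoid W"
proof (rule comm_monoidI)
  interpret P: UP_cring R "UP R" by unfold_locales
  fix u v w assume c: "u \<in> carrier W" "v \<in> carrier W" "w \<in> carrier W"
  have up: "trunc n u \<in> carrier (UP R)" "trunc n v \<in> carrier (UP R)"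
    "trunc n w \<in> carrier (UP R)" for n
    using c trunc_up by (simp_all add: UP_carrier)
  show "u \<otimes>\<^bsub>W\<^esub> v \<in> carrier W" using c by (simp add: witt_mult_closed)
  show "\<one>\<^bsub>W\<^esub> \<otimes>\<^bsub>W\<^esub> u = u"
  proof
    fix n
    have "trunc n \<one>\<^bsub>W\<^esub> = \<one>\<^bsub>UP R\<^esub>" by (auto simp: trunc_def witt_one UP_def)
    then show "(\<one>\<^bsub>W\<^esub> \<otimes>\<^bsub>W\<^esub> u) n = u n"
      using witt_mult_trunc[OF witt_one_closed c(1) order_refl, of n] P.UP_l_one[OF up(1)[of n]]
      by (simp add: trunc_def)
  qed
  show "u \<otimes>\<^bsub>W\<^esub> v = v \<otimes>\<^bsub>W\<^esub> u"
    using witt_mult_trunc[OF c(1,2) order_refl] witt_mult_trunc[OF c(2,1) order_refl]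
      P.UP_m_comm[OF up(1,2)] by fastforce
  show "u \<otimes>\<^bsub>W\<^esub> v \<otimes>\<^bsub>W\<^esub> w = u \<otimes>\<^bsub>W\<^esub> (v \<otimes>\<^bsub>W\<^esub> w)"
  proof
    fix n
    let ?u = "trunc n u" and ?v = "trunc n v" and ?w = "trunc n w"
    have uv: "?u \<otimes>\<^bsub>UP R\<^esub> ?v \<in> up R" and vw: "?v \<otimes>\<^bsub>UP R\<^esub> ?w \<in> up R"
      using P.UP_mult_closed[OF up(1,2)] P.UP_mult_closed[OF up(2,3)] by (simp_all add: UP_carrier)
    have "(u \<otimes>\<^bsub>W\<^esub> v \<otimes>\<^bsub>W\<^esub> w) n = (?u \<otimes>\<^bsub>UP R\<^esub> ?v \<otimes>\<^bsub>UP R\<^esub> ?w) n"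
      unfolding witt_mult[of "u \<otimes>\<^bsub>W\<^esub> v"] UP_mult[OF uv trunc_up[OF c(3)]]
    proof (rule finsum_cong')
      show "(\<lambda>i. (?u \<otimes>\<^bsub>UP R\<^esub> ?v) i \<otimes> ?w (n - i)) \<in> {..n} \<rightarrow> carrier R"
        using up_coeff[OF uv] up_coeff[OF trunc_up[OF c(3)]] by auto
    qed (use witt_mult_trunc[OF c(1,2), of _ n] in \<open>auto simp: trunc_eq\<close>)
    also have "\<dots> = (?u \<otimes>\<^bsub>UP R\<^esub> (?v \<otimes>\<^bsub>UP R\<^esub> ?w)) n"
      by (simp add: P.UP_m_assoc[OF up])
    also have "\<dots> = (u \<otimes>\<^bsub>W\<^esub> (v \<otimes>\<^bsub>W\<^esub> w)) n"
      unfolding witt_mult[of u] UP_mult[OF trunc_up[OF c(1)] vw]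
    proof (rule finsum_cong')
      show "(\<lambda>i. u i \<otimes> (v \<otimes>\<^bsub>W\<^esub> w) (n - i)) \<in> {..n} \<rightarrow> carrier R"
        using c witt_mult_closed by auto
    qed (use witt_mult_trunc[OF c(2,3), of _ n] in \<open>auto simp: trunc_eq\<close>)
    finally show "(u \<otimes>\<^bsub>W\<^esub> v \<otimes>\<^bsub>W\<^esub> w) n = (u \<otimes>\<^bsub>W\<^esub> (v \<otimes>\<^bsub>W\<^esub> w)) n" .
  qed
qed (rule witt_one_closed)

text \<open>Since \<open>w\<close> has constant term one, comparing coefficients of degree
  \<open>n + 1\<close> in \<open>w v = 1\<close> expresses \<open>v (n + 1)\<close> as minus the sum
  of the \<open>w (i + 1) v (n - i)\<close> for \<open>i \<le> n\<close>, which involves earlier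
  coefficients of \<open>v\<close> only.\<close>

lemma witt_right_inverse:
  assumes w: "w \<in> carrier W"
  shows "\<exists>v\<in>carrier W. w \<otimes>\<^bsub>W\<^esub> v = \<one>\<^bsub>W\<^esub>"
proof -
  \<comment> \<open>Primitive recursion sees only the previous value, so \<open>G n\<close> is a
    table holding all coefficients up to degree \<open>n\<close>; later entries still carry the
    initial value \<open>\<one>\<close>. The inverse is the diagonal.\<close>
  define G where "G = rec_nat (\<lambda>_. \<one>)
    (\<lambda>n h. h(Suc n := \<ominus> (\<Oplus>i\<in>{..n}. w (Suc i) \<otimes> h (n - i))))"
  define v where "v n = G n n" for n
  have G0: "G 0 = (\<lambda>_. \<one>)"
    and GS: "G (Suc n) = (G n)(Suc n := \<ominus> (\<Oplus>i\<in>{..n}. w (Suc i) \<otimes> G n (n - i)))" for n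
    by (simp_all add: G_def)
  have closed: "G n m \<in> carrier R" for n m
  proof (induction n arbitrary: m)
    case (Suc n)
    then show ?case using w by (auto simp: GS intro!: finsum_closed)
  qed (simp add: G0)
  have stable: "m \<le> n \<Longrightarrow> G n m = v m" for n m
  proof (induction n)
    case (Suc n)
    then show ?case by (cases "m = Suc n") (auto simp: GS v_def)
  qed (simp add: v_def)
  have v_closed: "v n \<in> carrier R" for n by (simp add: v_def closed)
  have vS: "v (Suc n) = \<ominus> (\<Oplus>i\<in>{..n}. w (Suc i) \<otimes> v (n - i))" for n
  proof -
    have "(\<Oplus>i\<in>{..n}. w (Suc i) \<otimes> G n (n - i)) = (\<Oplus>i\<in>{..n}. w (Suc i) \<otimes> v (n - i))"
      by (rule finsum_cong') (use w v_closed stable in auto)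
    then show ?thesis by (simp add: v_def GS)
  qed
  have v: "v \<in> carrier W" using v_closed by (simp add: witt_carrier v_def G0)
  have "(w \<otimes>\<^bsub>W\<^esub> v) n = \<one>\<^bsub>W\<^esub> n" for n
  proof (cases n)
    case 0
    then show ?thesis using w v by (simp add: witt_mult witt_one witt_carrier)
  next
    case (Suc m)
    let ?S = "\<Oplus>i\<in>{..m}. w (Suc i) \<otimes> v (m - i)"
    have S: "?S \<in> carrier R" using w v_closed by (auto intro!: finsum_closed)
    have "(w \<otimes>\<^bsub>W\<^esub> v) n = ?S \<oplus> w 0 \<otimes> v (Suc m)"
      unfolding Suc witt_mult using finsum_Suc2[of "\<lambda>i. w i \<otimes> v (Suc m - i)" m] w v_closed by simp
    also have "\<dots> = \<zero>" using w S by (simp add: witt_carrier vS r_neg)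
    finally show ?thesis by (simp add: Suc witt_one)
  qed
  then show ?thesis using v by blast
qed

lemma witt_comm_group: "comm_group W"
proof -
  interpret W: comm_monoid W by (rule witt_comm_monoid)
  show ?thesis
  proof (rule comm_groupI)
    fix x assume x: "x \<in> carrier W"
    then show "\<exists>y\<in>carrier W. y \<otimes>\<^bsub>W\<^esub> x = \<one>\<^bsub>W\<^esub>"
      using witt_right_inverse W.m_comm by metis
  qed (auto simp: W.m_assoc intro: W.m_comm)
qed

lemma witt_mult_up:
  assumes "p \<in> carrier W \<inter> up R" "q \<in> carrier W \<inter> up R"
  shows "p \<otimes>\<^bsub>W\<^esub> q \<in> carrier W \<inter> up R"
proof -
  have "p \<otimes>\<^bsub>W\<^esub> q = (\<lambda>n. \<Oplus>i\<in>{..n}. p i \<otimes> q (n - i))" by (rule ext) (rule witt_mult)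
  then show ?thesis using assms up_mult_closed[of p q] witt_mult_closed[of p q] by auto
qed

lemma witt_one_up: "\<one>\<^bsub>W\<^esub> \<in> carrier W \<inter> up R"
  using witt_one_closed up_one_closed by (simp add: witt_one)

lemma teich_up:
  assumes "a \<in> carrier R"
  shows "teich R a \<in> carrier W \<inter> up R"
proof -
  have "bound \<zero> 1 (teich R a)" by (auto simp: teich_def)
  moreover have "teich R a n \<in> carrier R" for n using assms by (auto simp: teich_def)
  ultimately have "teich R a \<in> up R" by blast
  then show ?thesis using assms by (auto simp: witt_carrier teich_def)
qed

lemma teich_zero: "teich R \<zero> = \<one>\<^bsub>W\<^esub>"
  by (auto simp: teich_def witt_one)

end

text \<open>Serves twice: for \<open>W_rat\<close>, and in the kernel argument for the fractions
  whose numerator and denominator do not vanish at \<open>1/c\<close>.\<close>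

lemma (in comm_group) fractions_subgroup:
  assumes "M \<subseteq> carrier G" "\<one> \<in> M" "\<And>p q. p \<in> M \<Longrightarrow> q \<in> M \<Longrightarrow> p \<otimes> q \<in> M"
  shows "subgroup {p \<otimes> inv q | p q. p \<in> M \<and> q \<in> M} G"
proof (rule subgroupI)
  show "{p \<otimes> inv q | p q. p \<in> M \<and> q \<in> M} \<subseteq> carrier G" using assms(1) by auto
  show "{p \<otimes> inv q | p q. p \<in> M \<and> q \<in> M} \<noteq> {}" using assms(2) by auto
next
  fix a assume "a \<in> {p \<otimes> inv q | p q. p \<in> M \<and> q \<in> M}"
  then obtain p q where a: "a = p \<otimes> inv q" "p \<in> M" "q \<in> M" by blast
  moreover have "p \<in> carrier G" "q \<in> carrier G" using a assms(1) by auto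
  ultimately have "inv a = q \<otimes> inv p" by (simp add: inv_mult_group)
  then show "inv a \<in> {p \<otimes> inv q | p q. p \<in> M \<and> q \<in> M}" using a by blast
next
  fix a b assume "a \<in> {p \<otimes> inv q | p q. p \<in> M \<and> q \<in> M}" "b \<in> {p \<otimes> inv q | p q. p \<in> M \<and> q \<in> M}"
  then obtain p q p' q' where a: "a = p \<otimes> inv q" "p \<in> M" "q \<in> M"
    and b: "b = p' \<otimes> inv q'" "p' \<in> M" "q' \<in> M" by blast
  have "p \<in> carrier G" "q \<in> carrier G" "p' \<in> carrier G" "q' \<in> carrier G"
    using a b assms(1) by auto
  then have "a \<otimes> b = (p \<otimes> p') \<otimes> inv (q \<otimes> q')"
    unfolding a b by (simp add: inv_mult m_ac)
  then show "a \<otimes> b \<in> {p \<otimes> inv q | p q. p \<in> M \<and> q \<in> M}" using a b assms(3) by blast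
qed

lemma (in comm_group) subgroup_finprod:
  assumes "subgroup H G" "\<And>a. a \<in> K \<Longrightarrow> f a \<in> H"
  shows "finprod G f K \<in> H"
  using assms(2)
proof (induction K rule: infinite_finite_induct)
  case (insert a K)
  interpret H: subgroup H G by fact
  show ?case using insert H.subset by (subst finprod_insert) auto
qed (auto simp: subgroup.one_closed[OF assms(1)])

context witt_ring
begin

lemma W_rat_subgroup: "subgroup (W_rat R) W"
proof -
  interpret W: comm_group W by (rule witt_comm_group)
  have "W_rat R = {p \<otimes>\<^bsub>W\<^esub> inv\<^bsub>W\<^esub> q | p q. p \<in> carrier W \<inter> up R \<and> q \<in> carrier W \<inter> up R}"
    by (simp add: W_rat_def)
  then show ?thesis
    using W.fractions_subgroup[of "carrier W \<inter> up R"] witt_one_up witt_mult_up by simp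
qed

lemma teich_W_rat:
  assumes "a \<in> carrier R"
  shows "teich R a \<in> W_rat R"
proof -
  interpret W: comm_group W by (rule witt_comm_group)
  have "teich R a = teich R a \<otimes>\<^bsub>W\<^esub> inv\<^bsub>W\<^esub> \<one>\<^bsub>W\<^esub>" using teich_up[OF assms] by simp
  then show ?thesis using teich_up[OF assms] witt_one_up unfolding W_rat_def by blast
qed

section \<open>The map omega\<close>

text \<open>Elements outside the support have exponent zero and contribute neutral factors. Supports
  can shrink by cancellation in a sum, so additivity is proved over a common index set.\<close>

lemma omega_superset:
  assumes "finite K" "Poly_Mapping.keys x \<subseteq> K" "K \<subseteq> carrier R"
  shows "omega_monoid_ring R x
    = (\<Otimes>\<^bsub>W\<^esub>a\<in>K. teich R a [^]\<^bsub>W\<^esub> Poly_Mapping.lookup x a)"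
proof -
  interpret W: comm_group W by (rule witt_comm_group)
  show ?thesis unfolding omega_monoid_ring_def
  proof (rule W.finprod_mono_neutral_cong_left[OF assms(1,2)])
    show "(\<lambda>a. teich R a [^]\<^bsub>W\<^esub> Poly_Mapping.lookup x a) \<in> K \<rightarrow> carrier W"
      using assms(3) teich_up by blast
  qed (auto simp: in_keys_iff)
qed

lemma omega_W_rat:
  assumes "Poly_Mapping.keys x \<subseteq> carrier R"
  shows "omega_monoid_ring R x \<in> W_rat R"
proof -
  interpret W: comm_group W by (rule witt_comm_group)
  show ?thesis unfolding omega_monoid_ring_def
    using assms W.subgroup_int_pow_closed[OF W_rat_subgroup teich_W_rat]
    by (intro W.subgroup_finprod W_rat_subgroup) auto
qed

lemma omega_closed:
  "Poly_Mapping.keys x \<subseteq> carrier R \<Longrightarrow> omega_monoid_ring R x \<in> carrier W"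
  using omega_W_rat subgroup.subset[OF W_rat_subgroup] by blast

lemma omega_add:
  assumes "Poly_Mapping.keys x \<subseteq> carrier R" "Poly_Mapping.keys y \<subseteq> carrier R"
  shows "omega_monoid_ring R (x + y) = omega_monoid_ring R x \<otimes>\<^bsub>W\<^esub> omega_monoid_ring R y"
proof -
  interpret W: comm_group W by (rule witt_comm_group)
  let ?K = "Poly_Mapping.keys x \<union> Poly_Mapping.keys y"
  have t: "teich R a \<in> carrier W" if "a \<in> ?K" for a using assms that teich_up by blast
  have "omega_monoid_ring R (x + y)
      = (\<Otimes>\<^bsub>W\<^esub>a\<in>?K. teich R a [^]\<^bsub>W\<^esub> Poly_Mapping.lookup (x + y) a)"
    by (rule omega_superset) (use assms keys_add[of x y] in auto)
  also have "\<dots> = (\<Otimes>\<^bsub>W\<^esub>a\<in>?K. teich R a [^]\<^bsub>W\<^esub> Poly_Mapping.lookup x a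
      \<otimes>\<^bsub>W\<^esub> teich R a [^]\<^bsub>W\<^esub> Poly_Mapping.lookup y a)"
    by (rule W.finprod_cong') (use t in \<open>auto simp: lookup_add W.int_pow_mult\<close>)
  also have "\<dots> = (\<Otimes>\<^bsub>W\<^esub>a\<in>?K. teich R a [^]\<^bsub>W\<^esub> Poly_Mapping.lookup x a)
      \<otimes>\<^bsub>W\<^esub> (\<Otimes>\<^bsub>W\<^esub>a\<in>?K. teich R a [^]\<^bsub>W\<^esub> Poly_Mapping.lookup y a)"
    by (rule W.finprod_multf) (use t in auto)
  also have "\<dots> = omega_monoid_ring R x \<otimes>\<^bsub>W\<^esub> omega_monoid_ring R y"
    using omega_superset[of ?K x] omega_superset[of ?K y] assms by simp
  finally show ?thesis .
qed

lemma omega_diff: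
  assumes "Poly_Mapping.keys x \<subseteq> carrier R" "Poly_Mapping.keys y \<subseteq> carrier R"
  shows "omega_monoid_ring R (x - y)
    = omega_monoid_ring R x \<otimes>\<^bsub>W\<^esub> inv\<^bsub>W\<^esub> (omega_monoid_ring R y)"
proof -
  interpret W: comm_group W by (rule witt_comm_group)
  have k: "Poly_Mapping.keys (x - y) \<subseteq> carrier R" using keys_diff[of x y] assms by blast
  show ?thesis
    using omega_add[OF k assms(2)] omega_closed k assms by (simp add: W.inv_solve_right)
qed

lemma omega_0: "omega_monoid_ring R 0 = \<one>\<^bsub>W\<^esub>"
proof -
  interpret W: comm_group W by (rule witt_comm_group)
  show ?thesis by (simp add: omega_monoid_ring_def)
qed

lemma omega_of: "a \<in> carrier R \<Longrightarrow> omega_monoid_ring R (frag_of a) = teich R a"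
proof -
  assume a: "a \<in> carrier R"
  interpret W: comm_group W by (rule witt_comm_group)
  show ?thesis using teich_up[OF a] by (simp add: omega_monoid_ring_def)
qed

lemma omega_zero_ideal: "z \<in> zero_ideal R \<Longrightarrow> omega_monoid_ring R z = \<one>\<^bsub>W\<^esub>"
proof -
  assume "z \<in> zero_ideal R"
  then obtain n where z: "z = frag_cmul n (frag_of \<zero>)" by (auto simp: zero_ideal_def)
  interpret W: comm_group W by (rule witt_comm_group)
  have "Poly_Mapping.keys z \<subseteq> {\<zero>}"
    by (auto simp: z in_keys_iff lookup_single when_def split: if_splits)
  then show ?thesis using omega_superset[of "{\<zero>}" z] by (simp add: teich_zero)
qed

end

section \<open>Cosets of the ideal generated by the zero element\<close>

definition zero_coset :: "'u ring \<Rightarrow> ('u \<Rightarrow>\<^sub>0 int) \<Rightarrow> ('u \<Rightarrow>\<^sub>0 int) set"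
  where "zero_coset A x = zero_ideal A +>\<^bsub>monoid_ring A\<^esub> x"

lemma zero_coset_iff: "y \<in> zero_coset A x \<longleftrightarrow> y - x \<in> zero_ideal A"
proof -
  have "y \<in> zero_coset A x \<longleftrightarrow> (\<exists>z\<in>zero_ideal A. y = z + x)"
    by (auto simp: zero_coset_def a_r_coset_def r_coset_def monoid_ring_def)
  also have "\<dots> \<longleftrightarrow> y - x \<in> zero_ideal A"
    by (metis add_diff_cancel diff_add_cancel)
  finally show ?thesis .
qed

lemma zero_ideal_zero: "0 \<in> zero_ideal A"
  unfolding zero_ideal_def by (metis frag_cmul_zero rangeI)

lemma zero_ideal_diff: "x \<in> zero_ideal A \<Longrightarrow> y \<in> zero_ideal A \<Longrightarrow> x - y \<in> zero_ideal A"
  unfolding zero_ideal_def by (auto simp flip: frag_cmul_diff_distrib)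

lemma zero_coset_eqI:
  assumes "x - y \<in> zero_ideal A"
  shows "zero_coset A x = zero_coset A y"
proof -
  have "z - x \<in> zero_ideal A \<longleftrightarrow> z - y \<in> zero_ideal A" for z
    using zero_ideal_diff[OF _ assms, of "z - y"]
      zero_ideal_diff[OF _ zero_ideal_diff[OF zero_ideal_zero assms], of "z - x"] by auto
  then show ?thesis by (auto simp: zero_coset_iff)
qed

lemma zero_coset_self: "x \<in> zero_coset A x"
  by (simp add: zero_coset_iff zero_ideal_zero)

lemma sect_reduced_monoid:
  "sect reduced_monoid_presheaf A = zero_coset A ` {x. Poly_Mapping.keys x \<subseteq> carrier A}"
proof -
  have "carrier (monoid_ring A) = {x. Poly_Mapping.keys x \<subseteq> carrier A}"
    by (simp add: monoid_ring_def)
  then have "sect reduced_monoid_presheaf A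
      = (\<Union>x\<in>{x. Poly_Mapping.keys x \<subseteq> carrier A}. {zero_coset A x})"
    by (simp only: reduced_monoid_presheaf_def reduced_monoid_ring_def FactRing_def
        A_RCOSETS_def' zero_coset_def presheaf.simps partial_object.simps)
  then show ?thesis by (simp only: UNION_singleton_eq_range)
qed

text \<open>Both \<open>omega\<close> and \<open>reduced_monoid_ring_map\<close> take the only
  element of the image of a coset; this evaluates them once constancy on the coset is known.\<close>

lemma the_elem_image_const:
  assumes "x \<in> X" "\<And>y. y \<in> X \<Longrightarrow> h y = h x"
  shows "the_elem (h ` X) = h x"
proof -
  have "h ` X = {h x}" using assms by blast
  then show ?thesis by simp
qed

lemma reduced_monoid_ring_map_coset:
  assumes "f \<zero>\<^bsub>A\<^esub> = \<zero>\<^bsub>B\<^esub>"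
  shows "reduced_monoid_ring_map B f (zero_coset A x) = zero_coset B (frag_extend (frag_of \<circ> f) x)"
proof -
  let ?h = "\<lambda>x. zero_coset B (frag_extend (frag_of \<circ> f) x)"
  have "frag_extend (frag_of \<circ> f) z \<in> zero_ideal B" if "z \<in> zero_ideal A" for z
    using that assms by (auto simp: zero_ideal_def frag_extend_cmul)
  then have "?h y = ?h x" if "y \<in> zero_coset A x" for y
    using that by (intro zero_coset_eqI) (auto simp: zero_coset_iff frag_extend_diff[symmetric])
  then have "the_elem (?h ` zero_coset A x) = ?h x"
    by (rule the_elem_image_const[OF zero_coset_self])
  then show ?thesis by (simp add: reduced_monoid_ring_map_def zero_coset_def comp_def)
qed

lemma keys_frag_push:
  assumes "Poly_Mapping.keys x \<subseteq> carrier A" "\<And>a. a \<in> carrier A \<Longrightarrow> f a \<in> carrier B"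
  shows "Poly_Mapping.keys (frag_extend (frag_of \<circ> f) x) \<subseteq> carrier B"
  using keys_frag_extend[of "frag_of \<circ> f" x] assms by (auto simp: keys_frag_of)

lemma omega_coset:
  assumes "cring A" "Poly_Mapping.keys x \<subseteq> carrier A"
  shows "omega A (zero_coset A x) = omega_monoid_ring A x"
proof -
  interpret witt_ring A using assms(1) by (rule witt_ring.intro)
  interpret W: comm_group W by (rule witt_comm_group)
  have "omega_monoid_ring A y = omega_monoid_ring A x" if "y \<in> zero_coset A x" for y
  proof -
    have z: "y - x \<in> zero_ideal A" using that by (simp add: zero_coset_iff)
    then have "Poly_Mapping.keys (y - x) \<subseteq> carrier A" by (auto simp: zero_ideal_def)
    then have "omega_monoid_ring A ((y - x) + x) = \<one>\<^bsub>W\<^esub> \<otimes>\<^bsub>W\<^esub> omega_monoid_ring A x"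
      using omega_add assms(2) omega_zero_ideal[OF z] by metis
    then show ?thesis using omega_closed[OF assms(2)] by simp
  qed
  then show ?thesis unfolding omega_def by (rule the_elem_image_const[OF zero_coset_self])
qed

section \<open>Functoriality\<close>

locale witt_hom = R: witt_ring R + S: witt_ring S + ring_hom_cring R S h
  for R :: "'a ring" (structure) and S :: "'b ring" (structure) and h
begin

lemma comp_carrier: "w \<in> carrier R.W \<Longrightarrow> h \<circ> w \<in> carrier S.W"
  by (simp add: R.witt_carrier S.witt_carrier)

lemma comp_hom: "(\<lambda>w. h \<circ> w) \<in> hom R.W S.W"
proof (rule homI)
  fix v w assume c: "v \<in> carrier R.W" "w \<in> carrier R.W"
  have "h (\<Oplus>i\<in>{..n}. v i \<otimes> w (n - i)) = (\<Oplus>\<^bsub>S\<^esub>i\<in>{..n}. h (v i) \<otimes>\<^bsub>S\<^esub> h (w (n - i)))" for n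
    using c by (subst hom_finsum) (auto intro!: S.finsum_cong')
  then show "h \<circ> (v \<otimes>\<^bsub>R.W\<^esub> w) = (h \<circ> v) \<otimes>\<^bsub>S.W\<^esub> (h \<circ> w)"
    by (intro ext) (simp add: R.witt_mult S.witt_mult)
qed (rule comp_carrier)

lemma comp_group_hom: "group_hom R.W S.W (\<lambda>w. h \<circ> w)"
  using comp_hom R.witt_comm_group S.witt_comm_group
  by (simp add: group_hom_def group_hom_axioms_def comm_group_def)

lemma comp_up: "p \<in> up R \<Longrightarrow> h \<circ> p \<in> up S"
proof (rule mem_upI)
  assume p: "p \<in> up R"
  show "(h \<circ> p) n \<in> carrier S" for n using R.up_coeff[OF p] by simp
  obtain n where "bound \<zero> n p" using p by blast
  then have "bound \<zero>\<^bsub>S\<^esub> n (h \<circ> p)" by (simp add: bound_def)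
  then show "\<exists>n. bound \<zero>\<^bsub>S\<^esub> n (h \<circ> p)" ..
qed

lemma comp_W_rat:
  assumes "w \<in> W_rat R"
  shows "h \<circ> w \<in> W_rat S"
proof -
  interpret group_hom R.W S.W "\<lambda>w. h \<circ> w" by (rule comp_group_hom)
  obtain p q where w: "w = p \<otimes>\<^bsub>R.W\<^esub> inv\<^bsub>R.W\<^esub> q"
    and pq: "p \<in> carrier R.W \<inter> up R" "q \<in> carrier R.W \<inter> up R"
    using assms by (auto simp: W_rat_def)
  have "h \<circ> w = (h \<circ> p) \<otimes>\<^bsub>S.W\<^esub> inv\<^bsub>S.W\<^esub> (h \<circ> q)"
    using pq hom_mult[of p "inv\<^bsub>R.W\<^esub> q"] hom_inv[of q] by (simp add: w)
  moreover have "h \<circ> p \<in> carrier S.W \<inter> up S" "h \<circ> q \<in> carrier S.W \<inter> up S"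
    using pq comp_carrier comp_up by auto
  ultimately show ?thesis unfolding W_rat_def by blast
qed

lemma comp_omega:
  assumes "Poly_Mapping.keys x \<subseteq> carrier R"
  shows "h \<circ> omega_monoid_ring R x = omega_monoid_ring S (frag_extend (frag_of \<circ> h) x)"
proof -
  interpret group_hom R.W S.W "\<lambda>w. h \<circ> w" by (rule comp_group_hom)
  \<comment> \<open>The difference step of \<open>frag_induction\<close> forgets the supports of the
    two terms, so the support condition is made part of the property.\<close>
  let ?P = "\<lambda>x. Poly_Mapping.keys x \<subseteq> carrier R \<and>
    h \<circ> omega_monoid_ring R x = omega_monoid_ring S (frag_extend (frag_of \<circ> h) x)"
  have "?P x" using assms
  proof (induction x rule: frag_induction)
    case zero
    show ?case using hom_one by (simp add: R.omega_0 S.omega_0)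
  next
    case (one a)
    then have "h \<circ> teich R a = teich S (h a)" by (auto simp: teich_def)
    then show ?case using one by (simp add: R.omega_of S.omega_of)
  next
    case (diff a b)
    have "Poly_Mapping.keys (a - b) \<subseteq> carrier R" using diff keys_diff[of a b] by blast
    have k: "Poly_Mapping.keys a \<subseteq> carrier R" "Poly_Mapping.keys b \<subseteq> carrier R"
      and eq: "h \<circ> omega_monoid_ring R a = omega_monoid_ring S (frag_extend (frag_of \<circ> h) a)"
        "h \<circ> omega_monoid_ring R b = omega_monoid_ring S (frag_extend (frag_of \<circ> h) b)"
      using diff by blast+
    have k': "Poly_Mapping.keys (frag_extend (frag_of \<circ> h) a) \<subseteq> carrier S"
      "Poly_Mapping.keys (frag_extend (frag_of \<circ> h) b) \<subseteq> carrier S"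
      using k keys_frag_push[of a R h S] keys_frag_push[of b R h S] by simp_all
    have "h \<circ> omega_monoid_ring R (a - b)
        = (h \<circ> omega_monoid_ring R a) \<otimes>\<^bsub>S.W\<^esub> inv\<^bsub>S.W\<^esub> (h \<circ> omega_monoid_ring R b)"
      using k hom_mult[of "omega_monoid_ring R a" "inv\<^bsub>R.W\<^esub> (omega_monoid_ring R b)"]
        hom_inv[of "omega_monoid_ring R b"]
      by (simp add: R.omega_diff R.omega_closed)
    also have "\<dots> = omega_monoid_ring S (frag_extend (frag_of \<circ> h) (a - b))"
      unfolding eq frag_extend_diff by (rule S.omega_diff[OF k', symmetric])
    finally have "h \<circ> omega_monoid_ring R (a - b)
        = omega_monoid_ring S (frag_extend (frag_of \<circ> h) (a - b))" .
    with \<open>Poly_Mapping.keys (a - b) \<subseteq> carrier R\<close> show ?case by blast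
  qed
  then show ?thesis by blast
qed

end

section \<open>Injectivity over integral domains\<close>

text \<open>
  For a polynomial \<open>w\<close> of degree at most \<open>N\<close> the value of the reversed polynomial
  \<open>T^N w(1/T)\<close> at \<open>c\<close>. It replaces evaluation at \<open>1/c\<close>, which would require the
  field of fractions.
\<close>

definition reverse_eval :: "('a, 'b) ring_scheme \<Rightarrow> 'a \<Rightarrow> nat \<Rightarrow> (nat \<Rightarrow> 'a) \<Rightarrow> 'a"
  where "reverse_eval R c N w = (\<Oplus>\<^bsub>R\<^esub>i\<in>{..N}. w i \<otimes>\<^bsub>R\<^esub> c [^]\<^bsub>R\<^esub> (N - i))"

lemma (in witt_ring) reverse_eval_closed:
  "c \<in> carrier R \<Longrightarrow> w \<in> carrier W \<Longrightarrow> reverse_eval R c N w \<in> carrier R"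
  by (auto simp: reverse_eval_def intro!: finsum_closed)

text \<open>Distributing \<open>c^(M+N-k)\<close> over the term \<open>v i * w (k-i)\<close> as
  \<open>c^(M-i)\<close> times \<open>c^(N-(k-i))\<close> turns the sum into the Cauchy product of
  the two reversed values.\<close>

lemma (in witt_ring) reverse_eval_mult:
  assumes c: "c \<in> carrier R" and v: "v \<in> carrier W" "bound \<zero> M v"
    and w: "w \<in> carrier W" "bound \<zero> N w"
  shows "reverse_eval R c (M + N) (v \<otimes>\<^bsub>W\<^esub> w) = reverse_eval R c M v \<otimes> reverse_eval R c N w"
    and "bound \<zero> (M + N) (v \<otimes>\<^bsub>W\<^esub> w)"
proof -
  let ?f = "\<lambda>i. v i \<otimes> c [^] (M - i)" and ?g = "\<lambda>i. w i \<otimes> c [^] (N - i)"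
  have v0: "v i = \<zero>" if "M < i" for i using bound.bound[OF v(2) that] .
  have w0: "w i = \<zero>" if "N < i" for i using bound.bound[OF w(2) that] .
  have "reverse_eval R c (M + N) (v \<otimes>\<^bsub>W\<^esub> w) = (\<Oplus>k\<in>{..M + N}. \<Oplus>i\<in>{..k}. ?f i \<otimes> ?g (k - i))"
    unfolding reverse_eval_def
  proof (rule finsum_cong')
    show "(\<lambda>k. \<Oplus>i\<in>{..k}. ?f i \<otimes> ?g (k - i)) \<in> {..M + N} \<rightarrow> carrier R"
      using c v w by (auto intro!: finsum_closed)
    fix k assume k: "k \<in> {..M + N}"
    have "(v \<otimes>\<^bsub>W\<^esub> w) k \<otimes> c [^] (M + N - k)
        = (\<Oplus>i\<in>{..k}. (v i \<otimes> w (k - i)) \<otimes> c [^] (M + N - k))"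
      using c v w by (simp add: witt_mult finsum_ldistr)
    also have "\<dots> = (\<Oplus>i\<in>{..k}. ?f i \<otimes> ?g (k - i))"
    proof (rule finsum_cong')
      show "(\<lambda>i. ?f i \<otimes> ?g (k - i)) \<in> {..k} \<rightarrow> carrier R" using c v w by auto
      fix i assume i: "i \<in> {..k}"
      show "(v i \<otimes> w (k - i)) \<otimes> c [^] (M + N - k) = ?f i \<otimes> ?g (k - i)"
      proof (cases "i \<le> M \<and> k - i \<le> N")
        case True
        then have "M + N - k = (M - i) + (N - (k - i))" using i by auto
        then have "c [^] (M + N - k) = c [^] (M - i) \<otimes> c [^] (N - (k - i))"
          using c by (simp add: nat_pow_mult)
        then show ?thesis using c v w by (simp add: m_ac)
      next
        \<comment> \<open>Subtraction of naturals truncates here and the exponents need not add up,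
          but one of \<open>v i\<close> and \<open>w (k - i)\<close> lies beyond its degree bound,
          so both sides vanish.\<close>
        case False
        then show ?thesis using c v w v0 w0 by (auto simp: not_le)
      qed
    qed simp
    finally show "(v \<otimes>\<^bsub>W\<^esub> w) k \<otimes> c [^] (M + N - k) = (\<Oplus>i\<in>{..k}. ?f i \<otimes> ?g (k - i))" .
  qed simp
  also have "\<dots> = reverse_eval R c M v \<otimes> reverse_eval R c N w"
    unfolding reverse_eval_def using c v w v0 w0
    by (intro cauchy_product) (auto simp: bound_def)
  finally show "reverse_eval R c (M + N) (v \<otimes>\<^bsub>W\<^esub> w) = reverse_eval R c M v \<otimes> reverse_eval R c N w" .
  show "bound \<zero> (M + N) (v \<otimes>\<^bsub>W\<^esub> w)"
  proof
    fix k assume k: "M + N < k"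
    have "v i \<otimes> w (k - i) = \<zero>" for i
      using v0[of i] w0[of "k - i"] k v w by (cases "M < i") auto
    then show "(v \<otimes>\<^bsub>W\<^esub> w) k = \<zero>" by (simp add: witt_mult)
  qed
qed

text \<open>Multiplicativity, with the unit series regarded as a polynomial of degree at most
  \<open>M\<close>: its reversed value is then \<open>c^M\<close>.\<close>

lemma (in witt_ring) reverse_eval_shift:
  assumes c: "c \<in> carrier R" and w: "w \<in> carrier W" "bound \<zero> N w"
  shows "reverse_eval R c (M + N) w = c [^] M \<otimes> reverse_eval R c N w"
proof -
  interpret W: comm_group W by (rule witt_comm_group)
  have b: "bound \<zero> M \<one>\<^bsub>W\<^esub>" by (auto simp: witt_one)
  have "reverse_eval R c M \<one>\<^bsub>W\<^esub> = (\<Oplus>i\<in>{..M}. if i = 0 then c [^] (M - i) else \<zero>)"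
    unfolding reverse_eval_def by (rule finsum_cong') (use c in \<open>auto simp: witt_one\<close>)
  also have "\<dots> = c [^] M"
    using add.finprod_singleton_swap[of 0 "{..M}" "\<lambda>i. c [^] (M - i)"] c by simp
  finally show ?thesis
    using reverse_eval_mult(1)[OF c witt_one_closed b w] w by simp
qed

text \<open>Reversing \<open>1 - aT\<close> gives \<open>T - a\<close>, so the value vanishes
  precisely for \<open>a = c\<close>.\<close>

lemma (in witt_ring) reverse_eval_teich:
  assumes "a \<in> carrier R" "c \<in> carrier R"
  shows "reverse_eval R c 1 (teich R a) = c \<ominus> a"
  using assms by (simp add: reverse_eval_def teich_def atMost_Suc a_minus_def a_comm)

locale witt_domain = witt_ring R + domain R for R :: "'a ring" (structure)

text \<open>Up to scaling by powers of \<open>c\<close>, which cannot vanish, the reversed value does not depend on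
  the chosen degree bound. So it separates the factors \<open>1 - aT\<close> with \<open>a \<noteq> c\<close> from \<open>1 - cT\<close>.\<close>

lemma (in witt_domain) omega_kernel:
  assumes keys: "Poly_Mapping.keys z \<subseteq> carrier R" and one: "omega_monoid_ring R z = \<one>\<^bsub>W\<^esub>"
  shows "Poly_Mapping.keys z \<subseteq> {\<zero>}"
proof (rule ccontr)
  interpret W: comm_group W by (rule witt_comm_group)
  assume "\<not> Poly_Mapping.keys z \<subseteq> {\<zero>}"
  then obtain c where c: "c \<in> Poly_Mapping.keys z" "c \<noteq> \<zero>" by blast
  then have cR: "c \<in> carrier R" using keys by blast
  \<comment> \<open>These are the polynomials with constant term one that do not vanish at
    \<open>1/c\<close>. Their fractions \<open>H\<close> form a group, which accommodates exponents
    of either sign.\<close>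
  define M where "M = {w \<in> carrier W. \<exists>N. bound \<zero> N w \<and> reverse_eval R c N w \<noteq> \<zero>}"
  define H where "H = {p \<otimes>\<^bsub>W\<^esub> inv\<^bsub>W\<^esub> q | p q. p \<in> M \<and> q \<in> M}"
  have "bound \<zero> 0 \<one>\<^bsub>W\<^esub>" "reverse_eval R c 0 \<one>\<^bsub>W\<^esub> \<noteq> \<zero>"
    by (auto simp: reverse_eval_def witt_one)
  then have "\<one>\<^bsub>W\<^esub> \<in> M" unfolding M_def using witt_one_closed by blast
  moreover have "p \<otimes>\<^bsub>W\<^esub> q \<in> M" if pq: "p \<in> M" "q \<in> M" for p q
  proof -
    obtain k l where kl: "bound \<zero> k p" "reverse_eval R c k p \<noteq> \<zero>"
      "bound \<zero> l q" "reverse_eval R c l q \<noteq> \<zero>" and p: "p \<in> carrier W" and q: "q \<in> carrier W"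
      using pq unfolding M_def by blast
    note m = reverse_eval_mult[OF cR p kl(1) q kl(3)]
    have "reverse_eval R c (k + l) (p \<otimes>\<^bsub>W\<^esub> q) \<noteq> \<zero>"
      using kl p q cR m(1) by (simp add: integral_iff reverse_eval_closed)
    then show ?thesis using m(2) p q unfolding M_def by blast
  qed
  ultimately have H: "subgroup H W"
    unfolding H_def by (intro W.fractions_subgroup) (auto simp: M_def)
  have teichM: "teich R a \<in> M" if a: "a \<in> carrier R" "a \<noteq> c" for a
  proof -
    have "bound \<zero> 1 (teich R a)" by (auto simp: teich_def)
    moreover have "reverse_eval R c 1 (teich R a) \<noteq> \<zero>"
      using a cR reverse_eval_teich[OF a(1) cR] by auto
    ultimately show ?thesis using teich_up[OF a(1)] unfolding M_def by blast
  qed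
  have teichH: "teich R a \<in> H" if a: "a \<in> carrier R" "a \<noteq> c" for a
  proof -
    have "teich R a = teich R a \<otimes>\<^bsub>W\<^esub> inv\<^bsub>W\<^esub> \<one>\<^bsub>W\<^esub>" using teich_up[OF a(1)] by simp
    then show ?thesis using teichM[OF a] \<open>\<one>\<^bsub>W\<^esub> \<in> M\<close> unfolding H_def by blast
  qed
  have notM: "teich R c \<otimes>\<^bsub>W\<^esub> q \<notin> M" if q: "q \<in> carrier W \<inter> up R" for q
  proof
    assume "teich R c \<otimes>\<^bsub>W\<^esub> q \<in> M"
    then obtain N where N: "bound \<zero> N (teich R c \<otimes>\<^bsub>W\<^esub> q)"
      "reverse_eval R c N (teich R c \<otimes>\<^bsub>W\<^esub> q) \<noteq> \<zero>" unfolding M_def by blast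
    have tc: "teich R c \<in> carrier W" "bound \<zero> 1 (teich R c)"
      using teich_up[OF cR] by (auto simp: teich_def)
    obtain k where k: "bound \<zero> k q" using q bound_upD by blast
    have qW: "q \<in> carrier W" and pq: "teich R c \<otimes>\<^bsub>W\<^esub> q \<in> carrier W" using q tc by auto
    note m = reverse_eval_mult[OF cR tc qW k]
    have "reverse_eval R c (1 + k) (teich R c \<otimes>\<^bsub>W\<^esub> q) = \<zero>"
      unfolding m(1) reverse_eval_teich[OF cR cR]
      using cR reverse_eval_closed[OF cR qW] by (simp add: a_minus_def r_neg)
    \<comment> \<open>The bound \<open>N\<close> comes from membership in \<open>M\<close>, the
      bound \<open>1 + k\<close> from the factorization. Both values are scaled to the common bound
      \<open>1 + k + N\<close>, where the second one gives zero.\<close>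
    then have "c [^] (1 + k) \<otimes> reverse_eval R c N (teich R c \<otimes>\<^bsub>W\<^esub> q) = \<zero>"
      using reverse_eval_shift[OF cR pq N(1), of "1 + k"] reverse_eval_shift[OF cR pq m(2), of N] cR
      by (simp add: add.commute)
    moreover have "c [^] (1 + k) \<noteq> \<zero>"
      by (induction k) (use c(2) cR in \<open>simp_all add: integral_iff\<close>)
    ultimately show False
      using N(2) reverse_eval_closed[OF cR pq] cR by (simp add: integral_iff del: nat_pow_Suc)
  qed
  let ?n = "Poly_Mapping.lookup z c" and ?K = "Poly_Mapping.keys z - {c}"
  let ?t = "teich R c" and ?r = "\<Otimes>\<^bsub>W\<^esub>a\<in>?K. teich R a [^]\<^bsub>W\<^esub> Poly_Mapping.lookup z a"
  have tc: "?t \<in> carrier W" using teich_up[OF cR] by simp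
  \<comment> \<open>All factors except the one for \<open>c\<close> lie in \<open>H\<close>. As the
    whole product is one, the power of \<open>1 - cT\<close> must lie in \<open>H\<close>
    too.\<close>
  have r: "?r \<in> H"
    using keys teichH W.subgroup_int_pow_closed[OF H] by (intro W.subgroup_finprod[OF H]) auto
  then have rW: "?r \<in> carrier W" using subgroup.subset[OF H] by blast
  have "omega_monoid_ring R z = ?t [^]\<^bsub>W\<^esub> ?n \<otimes>\<^bsub>W\<^esub> ?r"
  proof -
    have "omega_monoid_ring R z
        = (\<Otimes>\<^bsub>W\<^esub>a\<in>insert c ?K. teich R a [^]\<^bsub>W\<^esub> Poly_Mapping.lookup z a)"
      using c(1) by (simp add: omega_monoid_ring_def insert_absorb)
    also have "\<dots> = ?t [^]\<^bsub>W\<^esub> ?n \<otimes>\<^bsub>W\<^esub> ?r"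
      using keys teich_up by (intro W.finprod_insert) (use tc in auto)
    finally show ?thesis .
  qed
  then have "?t [^]\<^bsub>W\<^esub> ?n = inv\<^bsub>W\<^esub> ?r"
    using one tc rW by (metis W.int_pow_closed W.inv_equality)
  then have powH: "?t [^]\<^bsub>W\<^esub> ?n \<in> H" using subgroup.m_inv_closed[OF H r] by simp
  have "?n \<noteq> 0" using c(1) by (simp add: in_keys_iff)
  then obtain m :: nat where m: "m > 0" "?n = int m \<or> ?n = - int m"
    by (metis int_cases3)
  \<comment> \<open>A negative exponent is made positive by inverting within the group
    \<open>H\<close>.\<close>
  have "?t [^]\<^bsub>W\<^esub> m \<in> H"
  proof (cases "?n = int m")
    case True
    then show ?thesis using powH by (simp add: int_pow_int)
  next
    case False
    then have "inv\<^bsub>W\<^esub> (?t [^]\<^bsub>W\<^esub> m) \<in> H"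
      using m(2) powH tc by (simp add: W.int_pow_neg_int)
    then have "inv\<^bsub>W\<^esub> (inv\<^bsub>W\<^esub> (?t [^]\<^bsub>W\<^esub> m)) \<in> H" by (rule subgroup.m_inv_closed[OF H])
    then show ?thesis using tc by simp
  qed
  moreover obtain k where "m = Suc k" using m(1) gr0_conv_Suc by blast
  ultimately have "?t [^]\<^bsub>W\<^esub> Suc k \<in> H" by simp
  \<comment> \<open>Clearing the denominator writes \<open>p\<close> as \<open>1 - cT\<close> times
    the polynomial \<open>(1 - cT)^k q\<close>, in contradiction to \<open>notM\<close>. Splitting
    off one factor is possible because \<open>m\<close> is positive.\<close>
  then obtain p q where pq: "?t [^]\<^bsub>W\<^esub> Suc k = p \<otimes>\<^bsub>W\<^esub> inv\<^bsub>W\<^esub> q" "p \<in> M" "q \<in> M"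
    unfolding H_def by blast
  then have pqW: "p \<in> carrier W" "q \<in> carrier W" by (auto simp: M_def)
  have "q \<in> up R" using pq(3) by (auto simp: M_def witt_carrier)
  moreover have "?t [^]\<^bsub>W\<^esub> k \<in> carrier W \<inter> up R"
    by (induction k) (use witt_one_up witt_mult_up teich_up[OF cR] in auto)
  ultimately have "?t [^]\<^bsub>W\<^esub> k \<otimes>\<^bsub>W\<^esub> q \<in> carrier W \<inter> up R"
    using witt_mult_up pqW by blast
  moreover have "?t \<otimes>\<^bsub>W\<^esub> (?t [^]\<^bsub>W\<^esub> k \<otimes>\<^bsub>W\<^esub> q) = p"
  proof -
    have "?t [^]\<^bsub>W\<^esub> Suc k \<otimes>\<^bsub>W\<^esub> q = p" unfolding pq(1) using pqW by (simp add: W.m_assoc)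
    then show ?thesis using tc pqW by (simp add: W.m_ac)
  qed
  ultimately show False using notM pq(2) by metis
qed

text \<open>By additivity the difference of two representatives lies in the kernel. It is then
  supported at zero alone, which makes it an integer multiple of \<open>(0)\<close>.\<close>

lemma omega_inj_on:
  assumes "domain B"
  shows "inj_on (omega B) (sect reduced_monoid_presheaf B)"
proof (rule inj_onI)
  interpret witt_domain B
    using assms by (simp add: witt_domain_def witt_ring_def domain_def)
  interpret W: comm_group W by (rule witt_comm_group)
  fix X Y
  assume X: "X \<in> sect reduced_monoid_presheaf B" and Y: "Y \<in> sect reduced_monoid_presheaf B"
    and eq: "omega B X = omega B Y"
  obtain x where x: "X = zero_coset B x" "Poly_Mapping.keys x \<subseteq> carrier B"
    using X by (auto simp: sect_reduced_monoid)
  obtain y where y: "Y = zero_coset B y" "Poly_Mapping.keys y \<subseteq> carrier B"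
    using Y by (auto simp: sect_reduced_monoid)
  have "omega_monoid_ring B (x - y) = \<one>\<^bsub>W\<^esub>"
    using eq omega_coset[OF is_cring] x y omega_closed by (simp add: omega_diff)
  moreover have "Poly_Mapping.keys (x - y) \<subseteq> carrier B" using x(2) y(2) keys_diff[of x y] by blast
  ultimately have k: "Poly_Mapping.keys (x - y) \<subseteq> {\<zero>\<^bsub>B\<^esub>}" by (rule omega_kernel[rotated])
  have "x - y = frag_cmul (Poly_Mapping.lookup (x - y) \<zero>\<^bsub>B\<^esub>) (frag_of \<zero>\<^bsub>B\<^esub>)"
  proof (rule poly_mapping_eqI)
    fix a
    show "Poly_Mapping.lookup (x - y) a
      = Poly_Mapping.lookup (frag_cmul (Poly_Mapping.lookup (x - y) \<zero>\<^bsub>B\<^esub>) (frag_of \<zero>\<^bsub>B\<^esub>)) a"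
      using k by (cases "a = \<zero>\<^bsub>B\<^esub>") (auto simp: in_keys_iff lookup_single_not_eq)
  qed
  then have "x - y \<in> zero_ideal B" unfolding zero_ideal_def by blast
  then show "X = Y" unfolding x(1) y(1) by (rule zero_coset_eqI)
qed

section \<open>The morphism of presheaves\<close>

lemma rhom_witt_hom: "cring A \<Longrightarrow> cring B \<Longrightarrow> f \<in> rhom A B \<Longrightarrow> witt_hom A B f"
  by (simp add: witt_hom_def witt_ring_def ring_hom_cring_def ring_hom_cring_axioms_def rhom_def)

lemma omega_presheaf_morphism:
  assumes "pretopology C Cov" and cring: "\<And>A. A \<in> C \<Longrightarrow> cring A"
  shows "presheaf_morphism C Cov reduced_monoid_presheaf W_rat_presheaf omega"
proof -
  interpret pretopology C Cov by fact
  have site: "ring_site C Cov"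
    by (intro ring_site.intro ring_site_axioms.intro pretopology_axioms cring.axioms(1) cring)
  let ?push = "\<lambda>f. frag_extend (frag_of \<circ> f)"
  have res_coset: "res reduced_monoid_presheaf A B f (zero_coset A x) = zero_coset B (?push f x)"
    if "A \<in> C" "B \<in> C" "f \<in> rhom A B" for A B f x
  proof -
    interpret witt_hom A B f using rhom_witt_hom cring that by blast
    show ?thesis
      using reduced_monoid_ring_map_coset[of f A B x] by (simp add: reduced_monoid_presheaf_def)
  qed
  have keys_push: "Poly_Mapping.keys (?push f x) \<subseteq> carrier B"
    if "f \<in> rhom A B" "Poly_Mapping.keys x \<subseteq> carrier A" for A B f x
    by (rule keys_frag_push[OF that(2)]) (rule rhom_closed[OF that(1)])
  have F: "presheaf_on C Cov reduced_monoid_presheaf"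
  proof (intro presheaf_on.intro site presheaf_on_axioms.intro)
    fix A B f X
    assume C: "A \<in> C" "B \<in> C" "f \<in> rhom A B" and X: "X \<in> sect reduced_monoid_presheaf A"
    then obtain x where "X = zero_coset A x" "Poly_Mapping.keys x \<subseteq> carrier A"
      by (auto simp: sect_reduced_monoid)
    then show "res reduced_monoid_presheaf A B f X \<in> sect reduced_monoid_presheaf B"
      using res_coset[OF C] keys_push[OF C(3)] by (simp add: sect_reduced_monoid)
  next
    fix A X
    assume A: "A \<in> C" and X: "X \<in> sect reduced_monoid_presheaf A"
    then obtain x where x: "X = zero_coset A x" "Poly_Mapping.keys x \<subseteq> carrier A"
      by (auto simp: sect_reduced_monoid)
    \<comment> \<open>\<open>rid A\<close> is the identity on the carrier only, which suffices
      because it contains the support of \<open>x\<close>.\<close>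
    have "?push (rid A) x = frag_extend frag_of x"
      using x(2) by (intro frag_extend_eq) (auto simp: rid_def)
    then have "?push (rid A) x = x" by (simp flip: frag_expansion)
    moreover have "rid A \<in> rhom A A" using cring[OF A] by (simp add: rid_rhom cring_def)
    ultimately show "res reduced_monoid_presheaf A A (rid A) X = X"
      using res_coset[OF A A] x(1) by simp
  next
    fix A B D f g X
    assume C: "A \<in> C" "B \<in> C" "D \<in> C" "f \<in> rhom A B" "g \<in> rhom B D"
      and X: "X \<in> sect reduced_monoid_presheaf A"
    then obtain x where x: "X = zero_coset A x" "Poly_Mapping.keys x \<subseteq> carrier A"
      by (auto simp: sect_reduced_monoid)
    have "?push g (?push f x) = ?push (g \<circ> f) x"
      using frag_extend_compose[of "frag_of \<circ> g" f x] by (simp add: comp_assoc)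
    also have "\<dots> = ?push (compose (carrier A) g f) x"
      using x(2) by (intro frag_extend_eq) (auto simp: compose_def)
    finally show "res reduced_monoid_presheaf B D g (res reduced_monoid_presheaf A B f X)
        = res reduced_monoid_presheaf A D (compose (carrier A) g f) X"
      using res_coset C rhom_compose[of A f B g D] cring by (simp add: x(1) cring_def)
  qed
  \<comment> \<open>The identity and composition laws hold for extensional maps on carrier elements,
    so the coefficients must be known to lie there.\<close>
  have W_rat_coeff: "w n \<in> carrier A" if "A \<in> C" "w \<in> W_rat A" for A w n
  proof -
    interpret witt_ring A using cring[OF that(1)] by (rule witt_ring.intro)
    show ?thesis using that(2) subgroup.subset[OF W_rat_subgroup] witt_coeff by blast
  qed
  have G: "presheaf_on C Cov W_rat_presheaf"
  proof (intro presheaf_on.intro site presheaf_on_axioms.intro)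
    fix A B f w
    assume C: "A \<in> C" "B \<in> C" "f \<in> rhom A B" and w: "w \<in> sect W_rat_presheaf A"
    interpret witt_hom A B f using rhom_witt_hom cring C by blast
    show "res W_rat_presheaf A B f w \<in> sect W_rat_presheaf B"
      using comp_W_rat w by (simp add: W_rat_presheaf_def)
  next
    fix A w
    assume "A \<in> C" "w \<in> sect W_rat_presheaf A"
    then show "res W_rat_presheaf A A (rid A) w = w"
      using W_rat_coeff by (simp add: W_rat_presheaf_def rid_def fun_eq_iff)
  next
    fix A B D f g w
    assume "A \<in> C" "w \<in> sect W_rat_presheaf A"
    then show "res W_rat_presheaf B D g (res W_rat_presheaf A B f w)
        = res W_rat_presheaf A D (compose (carrier A) g f) w"
      using W_rat_coeff by (simp add: W_rat_presheaf_def compose_def fun_eq_iff)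
  qed
  have "omega A X \<in> sect W_rat_presheaf A"
    if A: "A \<in> C" and X: "X \<in> sect reduced_monoid_presheaf A" for A X
  proof -
    interpret witt_ring A using cring[OF A] by (rule witt_ring.intro)
    show ?thesis
      using X omega_coset[OF cring[OF A]] omega_W_rat
      by (auto simp: sect_reduced_monoid W_rat_presheaf_def)
  qed
  moreover have "omega B (res reduced_monoid_presheaf A B f X) = res W_rat_presheaf A B f (omega A X)"
    if C: "A \<in> C" "B \<in> C" "f \<in> rhom A B" and X: "X \<in> sect reduced_monoid_presheaf A" for A B f X
  proof -
    interpret witt_hom A B f using rhom_witt_hom cring C by blast
    obtain x where x: "X = zero_coset A x" "Poly_Mapping.keys x \<subseteq> carrier A"
      using X by (auto simp: sect_reduced_monoid)
    show ?thesis
      using comp_omega[OF x(2)] res_coset[OF C] omega_coset[OF cring[OF C(1)] x(2)]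
        omega_coset[OF cring[OF C(2)] keys_push[OF C(3) x(2)]]
      by (simp add: x(1) W_rat_presheaf_def)
  qed
  ultimately have "natural_on C reduced_monoid_presheaf W_rat_presheaf omega"
    by (simp add: natural_on_def)
  then show ?thesis
    by (intro presheaf_morphism.intro F G presheaf_morphism_axioms.intro)
qed

theorem proposition4p5:
  fixes C :: "'u ring set" and Cov :: "'u coverings" and A :: "'u ring"
  assumes "C = affine_schemes \<or> C = noetherian_affine_schemes"
    and "pretopology C Cov"
    and "A \<in> C"
    and "\<And>R. R \<in> Cov A \<Longrightarrow>
      \<exists>S\<in>Cov A. refines_covering A S R \<and> (\<forall>(B, g)\<in>S. domain B)"
  shows "inj_on (sheafify_map C Cov W_rat_presheaf omega A)
    (sect (sheafify C Cov reduced_monoid_presheaf) A)"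
proof (rule sheafify_map_inj_on[OF omega_presheaf_morphism[OF assms(2)] assms(3)])
  show "cring B" if "B \<in> C" for B
    using assms(1) that by (auto simp: affine_schemes_def noetherian_affine_schemes_def)
next
  fix R assume "R \<in> Cov A"
  then obtain S where S: "S \<in> Cov A" "refines_covering A S R" "\<forall>(B, g)\<in>S. domain B"
    using assms(4) by blast
  have "\<forall>(B, g)\<in>S. inj_on (omega B) (sect reduced_monoid_presheaf B)"
    using S(3) omega_inj_on by blast
  then show "\<exists>S\<in>Cov A. refines_covering A S R
      \<and> (\<forall>(B, g)\<in>S. inj_on (omega B) (sect reduced_monoid_presheaf B))"
    using S(1,2) by blast
qed

end
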